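(* Neither of the following adjunctions is a Quillen adjunction: $$q_{\mathrm{tag},!}:\mathrm{sSet}^{\mathrm{AInv}}_{\mathrm{DCH}}\rightleftarrows\mathrm{sSet}^{\dagger}_{\mathrm{Joyal}}:q_{\mathrm{tag}}^{*}\qquad\text{and}\qquad q_{\mathrm{tag}}^{*}:\mathrm{sSet}^{\dagger}_{\mathrm{Joyal}}\rightleftarrows\mathrm{sSet}^{\mathrm{AInv}}_{\mathrm{DCH}}:q_{\mathrm{tag},*}.$$ In particular, the dagger Joyal model structure is not obtained by restricting the DCH model structure to its strict fixed-vertex objects.
   Context: Anti-involutive and dagger simplicial sets. $\mathrm{sSet}^{\mathrm{AInv}}$ is the category of simplicial sets $X$ with an isomorphism $\tau:X\to X^{\mathrm{op}}$ satisfying $\tau^{\mathrm{op}}\tau=\mathrm{id}$, with equivariant simplicial maps. $\mathrm{sSet}^\dagger$ is the category of dagger simplicial sets: pairs $(X,\dagger_X)$ with $\dagger_X:X\to X^{\mathrm{op}}$, $\dagger_X^{\mathrm{op}}\dagger_X=\mathrm{id}$, and $\dagger_X$ the identity on vertices. Thus $\mathrm{sSet}^\dagger$ is the full subcategory of $\mathrm{sSet}^{\mathrm{AInv}}$ of objects with strictly fixed vertices, and $q_{\mathrm{tag}}^*:\mathrm{sSet}^\dagger\hookrightarrow\mathrm{sSet}^{\mathrm{AInv}}$ is this inclusion (it is precomposition with a functor $q_{\mathrm{tag}}$ of indexing categories for these presheaf categories). $q_{\mathrm{tag},!}$ and $q_{\mathrm{tag},*}$ are its left and right adjoints (left and right Kan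 extension). "Restricting" a model structure along $q^*_{\mathrm{tag}}$ means declaring a map $f$ of $\mathrm{sSet}^\dagger$ to be a weak equivalence, cofibration or fibration exactly when $q^*_{\mathrm{tag}}f$ is one. DCH model structure $\mathrm{sSet}^{\mathrm{AInv}}_{\mathrm{DCH}}$ (Drummond-Cole–Hackney): the model structure on $\mathrm{sSet}^{\mathrm{AInv}}$ whose weak equivalences and fibrations are the maps whose underlying simplicial maps are weak equivalences and fibrations in the ordinary Joyal model structure; its cofibrations are the normal monomorphisms (monomorphisms $A\to B$ for which the involution acts freely on the nondegenerate simplices of $B$ not in $A$, in every degree). Dagger Joyal model structure $\mathrm{sSet}^\dagger_{\mathrm{Joyal}}$: the model structure on $\mathrm{sSet}^\dagger$ whose cofibrations are the free cofibrations (monomorphisms $A\to B$ such that no nondegenerate positive-dimensional simplex $\sigma\in B\setminus A$ satisfies $\sigma^\dagger=\sigma$) and whose weak equivalences are the dagger Joyal equivalences, defined as follows. A dagger simplicial category is a small simplicial category $\mathcal C$ with simplicial maps $(-)^\dagger:\mathcal C(x,y)\to\mathcal C(y,x)$ with $(f^\dagger)^\dagger=f$, $\mathrm{id}_x^\dagger=\mathrm{id}_x$, $(gf)^\dagger=f^\dagger g^\dagger$; morphisms in $\mathrm{sCat}^\dagger$ are simplicial functors commuting with daggers. For a set $O$, $\mathrm{sCat}^\dagger_O$ has objects those with object set $O$ and morphisms that are the identity on $O$; it carries the fixed-object model structure whose weak equivalences (local weak equivalences) and fibrations are the weak homotopy equivalences and Kan fibrations on all mapping spaces. $\mathbb J_\dagger$: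 the dagger category with objects $0,1$ freely generated by $a:0\to1$ and $a^\dagger$. $\mathbb I_\dagger$: the dagger category with objects $0,1$ generated by $u:0\to1$, $u^\dagger$ with $u^\dagger u=\mathrm{id}_0$, $uu^\dagger=\mathrm{id}_1$. Both have discrete mapping spaces; $q:\mathbb J_\dagger\to\mathbb I_\dagger$ is identity on objects with $q(a)=u$. A natural dagger interval is a factorization $\mathbb J_\dagger\xrightarrow{j_{\mathbb H}}\mathbb H\xrightarrow{p_{\mathbb H}}\mathbb I_\dagger$ of $q$ in $\mathrm{sCat}^\dagger_{\{0,1\}}$ with $j_{\mathbb H}$ a fixed-object cofibration, $p_{\mathbb H}$ a local weak equivalence, and all mapping spaces of $\mathbb H$ countable; $h_{\mathbb H}:=j_{\mathbb H}(a)$. For objects $x,y$ of $\mathcal C$, $\mathcal C\langle x,y\rangle\in\mathrm{sCat}^\dagger_{\{0,1\}}$ has mapping spaces $\mathcal C(x_i,x_j)$ with $x_0=x,x_1=y$. Fix a functorial fixed-object fibrant replacement $r_\Theta:\Theta\to R\Theta$. $\mathrm h\mathcal C$ has hom-sets $\pi_0\mathcal C(x,y)$. The class $[u]$ of $u\in\mathcal C(x,y)_0$ is a coherently unitary equivalence if there are a natural dagger interval $\mathbb H$ and $\Phi:\mathbb H\to R(\mathcal C\langle x,y\rangle)$ in $\mathrm{sCat}^\dagger_{\{0,1\}}$ with $[\Phi(h_{\mathbb H})]=[r(u)]$ in $\pi_0R(\mathcal C\langle x,y\rangle)(0,1)$. A dagger simplicial functor $g:\mathcal C\to\mathcal D$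 is a dagger DK-equivalence if it induces weak homotopy equivalences on all mapping spaces and for every object $d$ of $\mathcal D$ there are $c\in\mathcal C$ and a coherently unitary equivalence $gc\to d$ in $\mathrm h\mathcal D$. Let $\mathfrak C$ be the ordinary rigidification functor (left adjoint of the homotopy coherent nerve), with canonical isomorphism $\chi_X:\mathfrak C(X^{\mathrm{op}})\cong\mathfrak C(X)^{\mathrm{op}}$; $\mathfrak C_\dagger(X)$ is $\mathfrak C(X)$ with dagger $\chi_X\circ\mathfrak C(\dagger_X)$. A map $f$ of $\mathrm{sSet}^\dagger$ is a dagger Joyal equivalence if $\mathfrak C_\dagger(f)$ is a dagger DK-equivalence. *)

theory Defs
  imports "HOL-Library.FuncSet" "HOL-Library.Countable_Set"
begin

section \<open>Categories, adjunctions and Quillen adjunctions\<close>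

record ('o, 'm) category =
  Obj :: "'o set"
  Hom :: "'o \<Rightarrow> 'o \<Rightarrow> 'm set"
  Idn :: "'o \<Rightarrow> 'm"
  Cmp :: "'o \<Rightarrow> 'o \<Rightarrow> 'o \<Rightarrow> 'm \<Rightarrow> 'm \<Rightarrow> 'm"
  \<comment> \<open>\<open>Cmp C X Y Z g f\<close> is the composite of \<open>f : X \<rightarrow> Y\<close> and \<open>g : Y \<rightarrow> Z\<close>\<close>

type_synonym ('o, 'm, 'p, 'n) fctr = "('o \<Rightarrow> 'p) \<times> ('o \<Rightarrow> 'o \<Rightarrow> 'm \<Rightarrow> 'n)"

definition is_functor ::
  "('o, 'm) category \<Rightarrow> ('p, 'n) category \<Rightarrow> ('o, 'm, 'p, 'n) fctr \<Rightarrow> bool" where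
  "is_functor C D F \<longleftrightarrow>
     (\<forall>X\<in>Obj C. fst F X \<in> Obj D) \<and>
     (\<forall>X\<in>Obj C. \<forall>Y\<in>Obj C. \<forall>f\<in>Hom C X Y. snd F X Y f \<in> Hom D (fst F X) (fst F Y)) \<and>
     (\<forall>X\<in>Obj C. snd F X X (Idn C X) = Idn D (fst F X)) \<and>
     (\<forall>X\<in>Obj C. \<forall>Y\<in>Obj C. \<forall>Z\<in>Obj C. \<forall>f\<in>Hom C X Y. \<forall>g\<in>Hom C Y Z.
        snd F X Z (Cmp C X Y Z g f) =
        Cmp D (fst F X) (fst F Y) (fst F Z) (snd F Y Z g) (snd F X Y f))"

definition adjunction ::
  "('o, 'm) category \<Rightarrow> ('p, 'n) category \<Rightarrow>
   ('o, 'm, 'p, 'n) fctr \<Rightarrow> ('p, 'n, 'o, 'm) fctr \<Rightarrow> bool" where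
  "adjunction C D L R \<longleftrightarrow> is_functor C D L \<and> is_functor D C R \<and>
     (\<exists>\<phi>.
        (\<forall>X\<in>Obj C. \<forall>Y\<in>Obj D.
           bij_betw (\<phi> X Y) (Hom D (fst L X) Y) (Hom C X (fst R Y))) \<and>
        (\<forall>X\<in>Obj C. \<forall>Y\<in>Obj D. \<forall>Y'\<in>Obj D. \<forall>g\<in>Hom D (fst L X) Y. \<forall>k\<in>Hom D Y Y'.
           \<phi> X Y' (Cmp D (fst L X) Y Y' k g) =
           Cmp C X (fst R Y) (fst R Y') (snd R Y Y' k) (\<phi> X Y g)) \<and>
        (\<forall>X'\<in>Obj C. \<forall>X\<in>Obj C. \<forall>Y\<in>Obj D. \<forall>g\<in>Hom D (fst L X) Y. \<forall>h\<in>Hom C X' X.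
           \<phi> X' Y (Cmp D (fst L X') (fst L X) Y g (snd L X' X h)) =
           Cmp C X' X (fst R Y) (\<phi> X Y g) h))"

text \<open>Only the three classes of maps of a model structure are recorded, not the axioms.\<close>

record ('o, 'm) model_classes =
  weq :: "'o \<Rightarrow> 'o \<Rightarrow> 'm \<Rightarrow> bool"
  cof :: "'o \<Rightarrow> 'o \<Rightarrow> 'm \<Rightarrow> bool"
  fib :: "'o \<Rightarrow> 'o \<Rightarrow> 'm \<Rightarrow> bool"

definition rlp ::
  "('o, 'm) category \<Rightarrow> ('o \<Rightarrow> 'o \<Rightarrow> 'm \<Rightarrow> bool) \<Rightarrow> 'o \<Rightarrow> 'o \<Rightarrow> 'm \<Rightarrow> bool" where
  "rlp C K X Y p \<longleftrightarrow>
     (\<forall>A\<in>Obj C. \<forall>B\<in>Obj C. \<forall>i\<in>Hom C A B. \<forall>u\<in>Hom C A X. \<forall>v\<in>Hom C B Y.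
        K A B i \<longrightarrow> Cmp C A X Y p u = Cmp C A B Y v i \<longrightarrow>
        (\<exists>l\<in>Hom C B X. Cmp C A B X l i = u \<and> Cmp C B X Y p l = v))"

definition quillen_adjunction ::
  "('o, 'm) category \<Rightarrow> ('o, 'm) model_classes \<Rightarrow> ('p, 'n) category \<Rightarrow> ('p, 'n) model_classes \<Rightarrow>
   ('o, 'm, 'p, 'n) fctr \<Rightarrow> ('p, 'n, 'o, 'm) fctr \<Rightarrow> bool" where
  "quillen_adjunction C M D N L R \<longleftrightarrow> adjunction C D L R \<and>
     (\<forall>X\<in>Obj C. \<forall>Y\<in>Obj C. \<forall>f\<in>Hom C X Y.
        (cof M X Y f \<longrightarrow> cof N (fst L X) (fst L Y) (snd L X Y f)) \<and>
        (cof M X Y f \<and> weq M X Y f \<longrightarrow>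
           cof N (fst L X) (fst L Y) (snd L X Y f) \<and>
           weq N (fst L X) (fst L Y) (snd L X Y f)))"

text \<open>The classes \<open>N\<close> on \<open>D\<close> are obtained by restricting the classes \<open>M\<close> along the functor \<open>Q\<close>.\<close>

definition is_restriction ::
  "('p, 'n) category \<Rightarrow> ('p, 'n) model_classes \<Rightarrow> ('p, 'n, 'o, 'm) fctr \<Rightarrow>
   ('o, 'm) model_classes \<Rightarrow> bool" where
  "is_restriction D N Q M \<longleftrightarrow>
     (\<forall>X\<in>Obj D. \<forall>Y\<in>Obj D. \<forall>f\<in>Hom D X Y.
        (weq N X Y f \<longleftrightarrow> weq M (fst Q X) (fst Q Y) (snd Q X Y f)) \<and>
        (cof N X Y f \<longleftrightarrow> cof M (fst Q X) (fst Q Y) (snd Q X Y f)) \<and>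
        (fib N X Y f \<longleftrightarrow> fib M (fst Q X) (fst Q Y) (snd Q X Y f)))"


section \<open>Simplicial sets\<close>

text \<open>
  Simplicial sets are functors on the opposite of the simplex category. The hom-set \<open>delta m n\<close>
  consists of the monotone maps from \<open>{..m}\<close> to \<open>{..n}\<close>, as extensional functions, and
  \<open>act X m n \<alpha>\<close> is the operator from the \<open>n\<close>-simplices to the \<open>m\<close>-simplices induced by \<open>\<alpha>\<close>.
  Small simplicial sets are those with simplices in a fixed type, which plays the role
  of the universe of sets.
\<close>

definition delta :: "nat \<Rightarrow> nat \<Rightarrow> (nat \<Rightarrow> nat) set" where
  "delta m n = {\<alpha> \<in> {..m} \<rightarrow>\<^sub>E {..n}. mono_on {..m} \<alpha>}"

record 'a sset =
  simp :: "nat \<Rightarrow> 'a set"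
  act :: "nat \<Rightarrow> nat \<Rightarrow> (nat \<Rightarrow> nat) \<Rightarrow> 'a \<Rightarrow> 'a"

definition is_sset :: "'a sset \<Rightarrow> bool" where
  "is_sset X \<longleftrightarrow>
     (\<forall>m n. \<forall>\<alpha>\<in>delta m n. \<forall>s\<in>simp X n. act X m n \<alpha> s \<in> simp X m) \<and>
     (\<forall>n. \<forall>s\<in>simp X n. act X n n (\<lambda>i\<in>{..n}. i) s = s) \<and>
     (\<forall>l m n. \<forall>\<beta>\<in>delta l m. \<forall>\<alpha>\<in>delta m n. \<forall>s\<in>simp X n.
        act X l n (compose {..l} \<alpha> \<beta>) s = act X l m \<beta> (act X m n \<alpha> s))"

definition smaps :: "'a sset \<Rightarrow> 'b sset \<Rightarrow> (nat \<Rightarrow> 'a \<Rightarrow> 'b) set" where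
  "smaps X Y = {f. (\<forall>n. f n \<in> simp X n \<rightarrow>\<^sub>E simp Y n) \<and>
     (\<forall>m n. \<forall>\<alpha>\<in>delta m n. \<forall>s\<in>simp X n. f m (act X m n \<alpha> s) = act Y m n \<alpha> (f n s))}"

definition sid :: "'a sset \<Rightarrow> nat \<Rightarrow> 'a \<Rightarrow> 'a" where
  "sid X = (\<lambda>n. \<lambda>s\<in>simp X n. s)"

definition scomp :: "'a sset \<Rightarrow> (nat \<Rightarrow> 'b \<Rightarrow> 'c) \<Rightarrow> (nat \<Rightarrow> 'a \<Rightarrow> 'b) \<Rightarrow> nat \<Rightarrow> 'a \<Rightarrow> 'c" where
  "scomp X g f = (\<lambda>n. compose (simp X n) (g n) (f n))"

definition sSet :: "('a sset, nat \<Rightarrow> 'a \<Rightarrow> 'a) category" where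
  "sSet = \<lparr>Obj = {X. is_sset X}, Hom = smaps, Idn = sid, Cmp = (\<lambda>X Y Z. scomp X)\<rparr>"

definition smono :: "'a sset \<Rightarrow> 'b sset \<Rightarrow> (nat \<Rightarrow> 'a \<Rightarrow> 'b) \<Rightarrow> bool" where
  "smono X Y f \<longleftrightarrow> (\<forall>n. inj_on (f n) (simp X n))"

definition sop :: "'a sset \<Rightarrow> 'a sset" where
  "sop X = \<lparr>simp = simp X, act = (\<lambda>m n \<alpha>. act X m n (\<lambda>i\<in>{..m}. n - \<alpha> (m - i)))\<rparr>"

definition sprod :: "'a sset \<Rightarrow> 'b sset \<Rightarrow> ('a \<times> 'b) sset" where
  "sprod X Y = \<lparr>simp = (\<lambda>n. simp X n \<times> simp Y n),
     act = (\<lambda>m n \<alpha>. map_prod (act X m n \<alpha>) (act Y m n \<alpha>))\<rparr>"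

definition discrete :: "'a set \<Rightarrow> 'a sset" where
  "discrete S = \<lparr>simp = (\<lambda>n. S), act = (\<lambda>m n \<alpha> s. s)\<rparr>"

definition nondegenerate :: "'a sset \<Rightarrow> nat \<Rightarrow> 'a \<Rightarrow> bool" where
  "nondegenerate X n s \<longleftrightarrow> s \<in> simp X n \<and>
     \<not> (\<exists>m<n. \<exists>\<alpha>\<in>delta n m. \<exists>t\<in>simp X m. s = act X n m \<alpha> t)"

definition vertex :: "'a sset \<Rightarrow> nat \<Rightarrow> nat \<Rightarrow> 'a \<Rightarrow> 'a" where
  "vertex X n i s = act X 0 n (\<lambda>_\<in>{..0}. i) s"

definition face :: "'a sset \<Rightarrow> nat \<Rightarrow> nat \<Rightarrow> 'a \<Rightarrow> 'a" where
  "face X n i s = act X n (Suc n) (\<lambda>j\<in>{..n}. if j < i then j else Suc j) s"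

text \<open>\<open>horn X n k x\<close>: the \<open>n\<close>-simplices \<open>x i\<close> with \<open>i \<le> Suc n\<close> and \<open>i \<noteq> k\<close> form a map to \<open>X\<close> from
  the \<open>k\<close>-th horn of dimension \<open>Suc n\<close>.\<close>

definition horn :: "'a sset \<Rightarrow> nat \<Rightarrow> nat \<Rightarrow> (nat \<Rightarrow> 'a) \<Rightarrow> bool" where
  "horn X n k x \<longleftrightarrow>
     (\<forall>i\<le>Suc n. i \<noteq> k \<longrightarrow> x i \<in> simp X n) \<and>
     (\<forall>m i j. n = Suc m \<and> i < j \<and> j \<le> Suc n \<and> i \<noteq> k \<and> j \<noteq> k \<longrightarrow>
        face X m i (x j) = face X m (j - 1) (x i))"

definition kan_complex :: "'a sset \<Rightarrow> bool" where
  "kan_complex X \<longleftrightarrow> is_sset X \<and>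
     (\<forall>n k x. k \<le> Suc n \<and> horn X n k x \<longrightarrow>
        (\<exists>z\<in>simp X (Suc n). \<forall>i\<le>Suc n. i \<noteq> k \<longrightarrow> face X n i z = x i))"

definition quasi_category :: "'a sset \<Rightarrow> bool" where
  "quasi_category X \<longleftrightarrow> is_sset X \<and>
     (\<forall>n k x. 0 < k \<and> k < Suc n \<and> horn X n k x \<longrightarrow>
        (\<exists>z\<in>simp X (Suc n). \<forall>i\<le>Suc n. i \<noteq> k \<longrightarrow> face X n i z = x i))"

definition kan_fibration :: "'a sset \<Rightarrow> 'b sset \<Rightarrow> (nat \<Rightarrow> 'a \<Rightarrow> 'b) \<Rightarrow> bool" where
  "kan_fibration X Y f \<longleftrightarrow>
     (\<forall>n k x y. k \<le> Suc n \<and> horn X n k x \<and> y \<in> simp Y (Suc n) \<and>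
        (\<forall>i\<le>Suc n. i \<noteq> k \<longrightarrow> face Y n i y = f n (x i)) \<longrightarrow>
        (\<exists>z\<in>simp X (Suc n). f (Suc n) z = y \<and> (\<forall>i\<le>Suc n. i \<noteq> k \<longrightarrow> face X n i z = x i)))"

definition pi0_eq :: "'a sset \<Rightarrow> 'a \<Rightarrow> 'a \<Rightarrow> bool" where
  "pi0_eq X = equivclp (\<lambda>v w. \<exists>e\<in>simp X 1. vertex X 1 0 e = v \<and> vertex X 1 1 e = w)"


section \<open>Weak homotopy equivalences and the Joyal model structure\<close>

text \<open>The standard 1-simplex, and the nerve of the contractible groupoid on two objects
  (whose \<open>n\<close>-simplices are all maps from \<open>{..n}\<close> to the set of objects).\<close>

definition simplex1 :: "(nat \<Rightarrow> nat) sset" where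
  "simplex1 = \<lparr>simp = (\<lambda>n. delta n 1), act = (\<lambda>m n \<alpha> s. compose {..m} s \<alpha>)\<rparr>"

definition iso_nerve :: "(nat \<Rightarrow> nat) sset" where
  "iso_nerve = \<lparr>simp = (\<lambda>n. {..n} \<rightarrow>\<^sub>E {0, 1}), act = (\<lambda>m n \<alpha> s. compose {..m} s \<alpha>)\<rparr>"

definition htpy_step ::
  "(nat \<Rightarrow> nat) sset \<Rightarrow> 'a sset \<Rightarrow> 'b sset \<Rightarrow> (nat \<Rightarrow> 'a \<Rightarrow> 'b) \<Rightarrow> (nat \<Rightarrow> 'a \<Rightarrow> 'b) \<Rightarrow> bool" where
  "htpy_step I A K f g \<longleftrightarrow> f \<in> smaps A K \<and> g \<in> smaps A K \<and>
     (\<exists>H\<in>smaps (sprod A I) K. \<forall>n. \<forall>s\<in>simp A n.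
        H n (s, \<lambda>_\<in>{..n}. 0) = f n s \<and> H n (s, \<lambda>_\<in>{..n}. 1) = g n s)"

abbreviation htpy ::
  "(nat \<Rightarrow> nat) sset \<Rightarrow> 'a sset \<Rightarrow> 'b sset \<Rightarrow> (nat \<Rightarrow> 'a \<Rightarrow> 'b) \<Rightarrow> (nat \<Rightarrow> 'a \<Rightarrow> 'b) \<Rightarrow> bool" where
  "htpy I A K \<equiv> equivclp (htpy_step I A K)"

text \<open>Precomposition with \<open>f\<close> is a bijection from homotopy classes of maps \<open>B \<rightarrow> K\<close> to
  homotopy classes of maps \<open>A \<rightarrow> K\<close>.\<close>

definition htpy_class_bij ::
  "(nat \<Rightarrow> nat) sset \<Rightarrow> 'a sset \<Rightarrow> 'b sset \<Rightarrow> (nat \<Rightarrow> 'a \<Rightarrow> 'b) \<Rightarrow> 'c sset \<Rightarrow> bool" where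
  "htpy_class_bij I A B f K \<longleftrightarrow>
     (\<forall>g\<in>smaps B K. \<forall>h\<in>smaps B K.
        htpy I A K (scomp A g f) (scomp A h f) \<longrightarrow> htpy I B K g h) \<and>
     (\<forall>k\<in>smaps A K. \<exists>g\<in>smaps B K. htpy I A K (scomp A g f) k)"

text \<open>
  The test objects \<open>K\<close> range over the universe of \<open>A\<close>. When that universe is infinite
  and \<open>B\<close> is not larger, it contains fibrant replacements of \<open>A\<close> and \<open>B\<close>, so that no
  larger test objects are needed.
\<close>

definition weak_htpy_equiv :: "'a sset \<Rightarrow> 'b sset \<Rightarrow> (nat \<Rightarrow> 'a \<Rightarrow> 'b) \<Rightarrow> bool" where
  "weak_htpy_equiv A B f \<longleftrightarrow>
     (\<forall>K :: 'a sset. kan_complex K \<longrightarrow> htpy_class_bij simplex1 A B f K)"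

definition joyal_equiv :: "'a sset \<Rightarrow> 'b sset \<Rightarrow> (nat \<Rightarrow> 'a \<Rightarrow> 'b) \<Rightarrow> bool" where
  "joyal_equiv A B f \<longleftrightarrow>
     (\<forall>K :: 'a sset. quasi_category K \<longrightarrow> htpy_class_bij iso_nerve A B f K)"

definition joyal_fibration :: "'a sset \<Rightarrow> 'a sset \<Rightarrow> (nat \<Rightarrow> 'a \<Rightarrow> 'a) \<Rightarrow> bool" where
  "joyal_fibration = rlp sSet (\<lambda>A B i. smono A B i \<and> joyal_equiv A B i)"


section \<open>Anti-involutive and dagger simplicial sets\<close>

record 'a isset =
  und :: "'a sset"
  inv_of :: "nat \<Rightarrow> 'a \<Rightarrow> 'a"

definition is_AInv :: "'a isset \<Rightarrow> bool" where
  "is_AInv X \<longleftrightarrow> is_sset (und X) \<and> inv_of X \<in> smaps (und X) (sop (und X)) \<and>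
     (\<forall>n. \<forall>s\<in>simp (und X) n. inv_of X n (inv_of X n s) = s)"

definition is_dagger :: "'a isset \<Rightarrow> bool" where
  "is_dagger X \<longleftrightarrow> is_AInv X \<and> (\<forall>v\<in>simp (und X) 0. inv_of X 0 v = v)"

definition equivariant_maps :: "'a isset \<Rightarrow> 'b isset \<Rightarrow> (nat \<Rightarrow> 'a \<Rightarrow> 'b) set" where
  "equivariant_maps X Y = {f \<in> smaps (und X) (und Y).
     \<forall>n. \<forall>s\<in>simp (und X) n. f n (inv_of X n s) = inv_of Y n (f n s)}"

definition sSet_AInv :: "('a isset, nat \<Rightarrow> 'a \<Rightarrow> 'a) category" where
  "sSet_AInv = \<lparr>Obj = {X. is_AInv X}, Hom = equivariant_maps,
     Idn = (\<lambda>X. sid (und X)), Cmp = (\<lambda>X Y Z. scomp (und X))\<rparr>"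

definition sSet_dagger :: "('a isset, nat \<Rightarrow> 'a \<Rightarrow> 'a) category" where
  "sSet_dagger = \<lparr>Obj = {X. is_dagger X}, Hom = equivariant_maps,
     Idn = (\<lambda>X. sid (und X)), Cmp = (\<lambda>X Y Z. scomp (und X))\<rparr>"

type_synonym 'a isset_functor = "('a isset, nat \<Rightarrow> 'a \<Rightarrow> 'a, 'a isset, nat \<Rightarrow> 'a \<Rightarrow> 'a) fctr"

definition qtag_star :: "'a isset_functor" where
  "qtag_star = ((\<lambda>X. X), (\<lambda>X Y f. f))"

text \<open>
  The left adjoint is the quotient identifying each vertex \<open>v\<close> with its image under the
  involution, and hence also the totally degenerate simplices on these two vertices.
  To stay inside the same type, \<open>tag_rep\<close> selects a representative of each class; the choice
  depends only on the class.
\<close>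

definition tag_rep :: "'a isset \<Rightarrow> nat \<Rightarrow> 'a \<Rightarrow> 'a" where
  "tag_rep X n s =
     (let v = vertex (und X) n 0 s; deg = act (und X) n 0 (\<lambda>_\<in>{..n}. 0)
      in if s = deg v then deg (SOME w. w \<in> {v, inv_of X 0 v}) else s)"

definition qtag_shriek_ob :: "'a isset \<Rightarrow> 'a isset" where
  "qtag_shriek_ob X =
     \<lparr>und = \<lparr>simp = (\<lambda>n. tag_rep X n ` simp (und X) n),
             act = (\<lambda>m n \<alpha> s. tag_rep X m (act (und X) m n \<alpha> s))\<rparr>,
      inv_of = (\<lambda>n. \<lambda>s\<in>tag_rep X n ` simp (und X) n. tag_rep X n (inv_of X n s))\<rparr>"

definition qtag_shriek :: "'a isset_functor" where
  "qtag_shriek = (qtag_shriek_ob,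
     (\<lambda>X Y f n. \<lambda>s\<in>simp (und (qtag_shriek_ob X)) n. tag_rep Y n (f n s)))"

text \<open>The right adjoint selects the simplices all of whose vertices are fixed.\<close>

definition fixed_simp :: "'a isset \<Rightarrow> nat \<Rightarrow> 'a set" where
  "fixed_simp X n = {s \<in> simp (und X) n.
     \<forall>i\<le>n. inv_of X 0 (vertex (und X) n i s) = vertex (und X) n i s}"

definition qtag_lower_star :: "'a isset_functor" where
  "qtag_lower_star =
     ((\<lambda>X. \<lparr>und = \<lparr>simp = fixed_simp X, act = act (und X)\<rparr>,
            inv_of = (\<lambda>n. restrict (inv_of X n) (fixed_simp X n))\<rparr>),
      (\<lambda>X Y f n. restrict (f n) (fixed_simp X n)))"

definition normal_mono :: "'a isset \<Rightarrow> 'b isset \<Rightarrow> (nat \<Rightarrow> 'a \<Rightarrow> 'b) \<Rightarrow> bool" where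
  "normal_mono A B f \<longleftrightarrow> smono (und A) (und B) f \<and>
     (\<forall>n s. nondegenerate (und B) n s \<and> s \<notin> f n ` simp (und A) n \<longrightarrow> inv_of B n s \<noteq> s)"

definition free_cofibration :: "'a isset \<Rightarrow> 'b isset \<Rightarrow> (nat \<Rightarrow> 'a \<Rightarrow> 'b) \<Rightarrow> bool" where
  "free_cofibration A B f \<longleftrightarrow> smono (und A) (und B) f \<and>
     (\<forall>n s. n > 0 \<and> nondegenerate (und B) n s \<and> s \<notin> f n ` simp (und A) n \<longrightarrow> inv_of B n s \<noteq> s)"

definition DCH_model :: "('a isset, nat \<Rightarrow> 'a \<Rightarrow> 'a) model_classes" where
  "DCH_model = \<lparr>weq = (\<lambda>X Y. joyal_equiv (und X) (und Y)),
     cof = normal_mono,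
     fib = (\<lambda>X Y. joyal_fibration (und X) (und Y))\<rparr>"


section \<open>Simplicial categories and dagger simplicial categories\<close>

record ('o, 'm) scat =
  ob :: "'o set"
  mapsp :: "'o \<Rightarrow> 'o \<Rightarrow> 'm sset"
  ident :: "'o \<Rightarrow> 'm"
  cmp :: "'o \<Rightarrow> 'o \<Rightarrow> 'o \<Rightarrow> nat \<Rightarrow> 'm \<Rightarrow> 'm \<Rightarrow> 'm"
  \<comment> \<open>\<open>cmp C x y z n g f\<close> composes the \<open>n\<close>-simplices \<open>g\<close> of \<open>mapsp C y z\<close> and \<open>f\<close> of \<open>mapsp C x y\<close>\<close>

record ('o, 'm) dscat = "('o, 'm) scat" +
  dag :: "'o \<Rightarrow> 'o \<Rightarrow> nat \<Rightarrow> 'm \<Rightarrow> 'm"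

definition ident_at :: "('o, 'm, 'z) scat_scheme \<Rightarrow> 'o \<Rightarrow> nat \<Rightarrow> 'm" where
  "ident_at C x n = act (mapsp C x x) n 0 (\<lambda>_\<in>{..n}. 0) (ident C x)"

definition is_scat :: "('o, 'm, 'z) scat_scheme \<Rightarrow> bool" where
  "is_scat C \<longleftrightarrow>
     (\<forall>x\<in>ob C. \<forall>y\<in>ob C. is_sset (mapsp C x y)) \<and>
     (\<forall>x\<in>ob C. ident C x \<in> simp (mapsp C x x) 0) \<and>
     (\<forall>x\<in>ob C. \<forall>y\<in>ob C. \<forall>z\<in>ob C. \<forall>n. \<forall>g\<in>simp (mapsp C y z) n. \<forall>f\<in>simp (mapsp C x y) n.
        cmp C x y z n g f \<in> simp (mapsp C x z) n \<and>
        (\<forall>m. \<forall>\<alpha>\<in>delta m n. act (mapsp C x z) m n \<alpha> (cmp C x y z n g f) =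
           cmp C x y z m (act (mapsp C y z) m n \<alpha> g) (act (mapsp C x y) m n \<alpha> f))) \<and>
     (\<forall>w\<in>ob C. \<forall>x\<in>ob C. \<forall>y\<in>ob C. \<forall>z\<in>ob C. \<forall>n. \<forall>h\<in>simp (mapsp C y z) n.
        \<forall>g\<in>simp (mapsp C x y) n. \<forall>f\<in>simp (mapsp C w x) n.
        cmp C w y z n h (cmp C w x y n g f) = cmp C w x z n (cmp C x y z n h g) f) \<and>
     (\<forall>x\<in>ob C. \<forall>y\<in>ob C. \<forall>n. \<forall>f\<in>simp (mapsp C x y) n.
        cmp C x x y n f (ident_at C x n) = f \<and> cmp C x y y n (ident_at C y n) f = f)"

definition is_dscat :: "('o, 'm) dscat \<Rightarrow> bool" where
  "is_dscat C \<longleftrightarrow> is_scat C \<and>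
     (\<forall>x\<in>ob C. \<forall>y\<in>ob C. dag C x y \<in> smaps (mapsp C x y) (mapsp C y x)) \<and>
     (\<forall>x\<in>ob C. \<forall>y\<in>ob C. \<forall>n. \<forall>f\<in>simp (mapsp C x y) n. dag C y x n (dag C x y n f) = f) \<and>
     (\<forall>x\<in>ob C. dag C x x 0 (ident C x) = ident C x) \<and>
     (\<forall>x\<in>ob C. \<forall>y\<in>ob C. \<forall>z\<in>ob C. \<forall>n. \<forall>g\<in>simp (mapsp C y z) n. \<forall>f\<in>simp (mapsp C x y) n.
        dag C x z n (cmp C x y z n g f) = cmp C z y x n (dag C x y n f) (dag C y z n g))"

text \<open>The morphisms of \<open>sCat\<^sup>\<dagger>\<close> between dagger simplicial categories with the same objects that
  are the identity on objects.\<close>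

definition fixed_ob_functors ::
  "('o, 'a) dscat \<Rightarrow> ('o, 'b) dscat \<Rightarrow> ('o \<Rightarrow> 'o \<Rightarrow> nat \<Rightarrow> 'a \<Rightarrow> 'b) set" where
  "fixed_ob_functors C D = {F.
     (\<forall>x\<in>ob C. \<forall>y\<in>ob C. F x y \<in> smaps (mapsp C x y) (mapsp D x y)) \<and>
     (\<forall>x\<in>ob C. F x x 0 (ident C x) = ident D x) \<and>
     (\<forall>x\<in>ob C. \<forall>y\<in>ob C. \<forall>z\<in>ob C. \<forall>n. \<forall>g\<in>simp (mapsp C y z) n. \<forall>f\<in>simp (mapsp C x y) n.
        F x z n (cmp C x y z n g f) = cmp D x y z n (F y z n g) (F x y n f)) \<and>
     (\<forall>x\<in>ob C. \<forall>y\<in>ob C. \<forall>n. \<forall>f\<in>simp (mapsp C x y) n.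
        F y x n (dag C x y n f) = dag D x y n (F x y n f))}"

text \<open>The category \<open>sCat\<^sup>\<dagger>\<close> for the object set \<open>{0,1}\<close>; here \<open>False\<close> is 0 and \<open>True\<close> is 1.\<close>

definition dsCat01 :: "((bool, 'm) dscat, bool \<Rightarrow> bool \<Rightarrow> nat \<Rightarrow> 'm \<Rightarrow> 'm) category" where
  "dsCat01 = \<lparr>Obj = {C. is_dscat C \<and> ob C = UNIV}, Hom = fixed_ob_functors,
     Idn = (\<lambda>C x y. sid (mapsp C x y)),
     Cmp = (\<lambda>C D E G F x y. scomp (mapsp C x y) (G x y) (F x y))\<rparr>"

definition local_weak_equiv ::
  "('o, 'a) dscat \<Rightarrow> ('o, 'b) dscat \<Rightarrow> ('o \<Rightarrow> 'o \<Rightarrow> nat \<Rightarrow> 'a \<Rightarrow> 'b) \<Rightarrow> bool" where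
  "local_weak_equiv C D F \<longleftrightarrow>
     (\<forall>x\<in>ob C. \<forall>y\<in>ob C. weak_htpy_equiv (mapsp C x y) (mapsp D x y) (F x y))"

definition local_fibration ::
  "('o, 'a) dscat \<Rightarrow> ('o, 'b) dscat \<Rightarrow> ('o \<Rightarrow> 'o \<Rightarrow> nat \<Rightarrow> 'a \<Rightarrow> 'b) \<Rightarrow> bool" where
  "local_fibration C D F \<longleftrightarrow>
     (\<forall>x\<in>ob C. \<forall>y\<in>ob C. kan_fibration (mapsp C x y) (mapsp D x y) (F x y))"

text \<open>Left lifting property against the trivial fibrations in the universe of \<open>B\<close>.\<close>

definition fixed_ob_cofibration ::
  "(bool, 'a) dscat \<Rightarrow> (bool, 'b) dscat \<Rightarrow> (bool \<Rightarrow> bool \<Rightarrow> nat \<Rightarrow> 'a \<Rightarrow> 'b) \<Rightarrow> bool" where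
  "fixed_ob_cofibration A B j \<longleftrightarrow>
     (\<forall>(P :: (bool, 'b) dscat)\<in>Obj dsCat01. \<forall>(Q :: (bool, 'b) dscat)\<in>Obj dsCat01.
      \<forall>p\<in>fixed_ob_functors P Q. \<forall>u\<in>fixed_ob_functors A P. \<forall>v\<in>fixed_ob_functors B Q.
        local_weak_equiv P Q p \<and> local_fibration P Q p \<and>
        (\<forall>x y n. \<forall>s\<in>simp (mapsp A x y) n. p x y n (u x y n s) = v x y n (j x y n s)) \<longrightarrow>
        (\<exists>l\<in>fixed_ob_functors B P.
           (\<forall>x y n. \<forall>s\<in>simp (mapsp A x y) n. l x y n (j x y n s) = u x y n s) \<and>
           (\<forall>x y n. \<forall>s\<in>simp (mapsp B x y) n. p x y n (l x y n s) = v x y n s)))"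

type_synonym 'm dscat01_functor =
  "((bool, 'm) dscat, bool \<Rightarrow> bool \<Rightarrow> nat \<Rightarrow> 'm \<Rightarrow> 'm,
    (bool, 'm) dscat, bool \<Rightarrow> bool \<Rightarrow> nat \<Rightarrow> 'm \<Rightarrow> 'm) fctr"

type_synonym 'm dscat01_family =
  "(bool, 'm) dscat \<Rightarrow> bool \<Rightarrow> bool \<Rightarrow> nat \<Rightarrow> 'm \<Rightarrow> 'm"

definition fibrant_replacement :: "'m dscat01_functor \<Rightarrow> 'm dscat01_family \<Rightarrow> bool" where
  "fibrant_replacement R r \<longleftrightarrow> is_functor dsCat01 dsCat01 R \<and>
     (\<forall>\<Theta>\<in>Obj dsCat01.
        (\<forall>x y. kan_complex (mapsp (fst R \<Theta>) x y)) \<and>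
        r \<Theta> \<in> Hom dsCat01 \<Theta> (fst R \<Theta>) \<and> local_weak_equiv \<Theta> (fst R \<Theta>) (r \<Theta>)) \<and>
     (\<forall>\<Theta>\<in>Obj dsCat01. \<forall>\<Theta>'\<in>Obj dsCat01. \<forall>F\<in>Hom dsCat01 \<Theta> \<Theta>'.
        Cmp dsCat01 \<Theta> (fst R \<Theta>) (fst R \<Theta>') (snd R \<Theta> \<Theta>' F) (r \<Theta>) =
        Cmp dsCat01 \<Theta> \<Theta>' (fst R \<Theta>') (r \<Theta>') F)"

text \<open>
  In the dagger category freely generated by \<open>a : 0 \<rightarrow> 1\<close> and its dagger, a morphism
  \<open>x \<rightarrow> y\<close> is an alternating word in \<open>a\<close> and its dagger, determined by its source and its length, and
  the length is even iff \<open>x = y\<close>. So words are encoded by their lengths: composition is addition,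
  the dagger preserves length, and \<open>a\<close> is the word of length 1 from 0 to 1.
\<close>

definition J_dagger :: "(bool, nat) dscat" where
  "J_dagger = \<lparr>ob = UNIV, mapsp = (\<lambda>x y. discrete {l. even l \<longleftrightarrow> x = y}), ident = (\<lambda>x. 0),
     cmp = (\<lambda>x y z n g f. g + f), dag = (\<lambda>x y n. \<lambda>l\<in>{l. even l \<longleftrightarrow> x = y}. l)\<rparr>"

text \<open>Imposing the two unitarity relations leaves exactly one morphism between any two objects.\<close>

definition I_dagger :: "(bool, nat) dscat" where
  "I_dagger = \<lparr>ob = UNIV, mapsp = (\<lambda>x y. discrete {0}), ident = (\<lambda>x. 0),
     cmp = (\<lambda>x y z n g f. 0), dag = (\<lambda>x y n. \<lambda>l\<in>{0}. 0)\<rparr>"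

definition q_JI :: "bool \<Rightarrow> bool \<Rightarrow> nat \<Rightarrow> nat \<Rightarrow> nat" where
  "q_JI = (\<lambda>x y n. \<lambda>l\<in>{l. even l \<longleftrightarrow> x = y}. 0)"

definition natural_dagger_interval ::
  "(bool, 'm) dscat \<Rightarrow> (bool \<Rightarrow> bool \<Rightarrow> nat \<Rightarrow> nat \<Rightarrow> 'm) \<Rightarrow>
   (bool \<Rightarrow> bool \<Rightarrow> nat \<Rightarrow> 'm \<Rightarrow> nat) \<Rightarrow> bool" where
  "natural_dagger_interval \<H> j p \<longleftrightarrow> \<H> \<in> Obj dsCat01 \<and>
     j \<in> fixed_ob_functors J_dagger \<H> \<and> p \<in> fixed_ob_functors \<H> I_dagger \<and>
     (\<forall>x y n. \<forall>l\<in>simp (mapsp J_dagger x y) n. p x y n (j x y n l) = q_JI x y n l) \<and>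
     fixed_ob_cofibration J_dagger \<H> j \<and> local_weak_equiv \<H> I_dagger p \<and>
     (\<forall>x y n. countable (simp (mapsp \<H> x y) n))"

definition two_objects :: "('o, 'm) dscat \<Rightarrow> 'o \<Rightarrow> 'o \<Rightarrow> (bool, 'm) dscat" where
  "two_objects C x y = (let p = (\<lambda>i. if i then y else x) in
     \<lparr>ob = UNIV, mapsp = (\<lambda>i j. mapsp C (p i) (p j)), ident = (\<lambda>i. ident C (p i)),
      cmp = (\<lambda>i j k. cmp C (p i) (p j) (p k)), dag = (\<lambda>i j. dag C (p i) (p j))\<rparr>)"

text \<open>\<open>coherently_unitary R r C x y u\<close>: the class of the vertex \<open>u\<close> of \<open>mapsp C x y\<close> is a coherently
  unitary equivalence; \<open>j False True 0 1\<close> is the image of the generator \<open>a\<close> in \<open>\<H>\<close>.\<close>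

definition coherently_unitary ::
  "'m dscat01_functor \<Rightarrow> 'm dscat01_family \<Rightarrow> ('o, 'm) dscat \<Rightarrow> 'o \<Rightarrow> 'o \<Rightarrow> 'm \<Rightarrow> bool" where
  "coherently_unitary R r C x y u \<longleftrightarrow>
     (\<exists>(\<H> :: (bool, 'm) dscat) j p. natural_dagger_interval \<H> j p \<and>
        (\<exists>\<Phi>\<in>fixed_ob_functors \<H> (fst R (two_objects C x y)).
           pi0_eq (mapsp (fst R (two_objects C x y)) False True)
             (\<Phi> False True 0 (j False True 0 1))
             (r (two_objects C x y) False True 0 u)))"

definition dagger_DK_equiv ::
  "'m dscat01_functor \<Rightarrow> 'm dscat01_family \<Rightarrow> ('o, 'm) dscat \<Rightarrow> ('p, 'm) dscat \<Rightarrow>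
   ('o \<Rightarrow> 'p) \<Rightarrow> ('o \<Rightarrow> 'o \<Rightarrow> nat \<Rightarrow> 'm \<Rightarrow> 'm) \<Rightarrow> bool" where
  "dagger_DK_equiv R r C D Fo Fm \<longleftrightarrow>
     (\<forall>x\<in>ob C. \<forall>y\<in>ob C.
        weak_htpy_equiv (mapsp C x y) (mapsp D (Fo x) (Fo y)) (Fm x y)) \<and>
     (\<forall>d\<in>ob D. \<exists>c\<in>ob C. \<exists>u\<in>simp (mapsp D (Fo c) d) 0. coherently_unitary R r D (Fo c) d u)"


section \<open>Rigidification\<close>

text \<open>
  For the standard \<open>n\<close>-simplex, the mapping space from \<open>i\<close> to \<open>j\<close> of the rigidification is the nerve of
  the poset of subsets of \<open>{i..j}\<close> containing \<open>i\<close> and \<open>j\<close>; composition is union. Its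
  \<open>k\<close>-simplices are the elements of \<open>chains i j k\<close>.
\<close>

definition chains :: "nat \<Rightarrow> nat \<Rightarrow> nat \<Rightarrow> (nat \<Rightarrow> nat set) set" where
  "chains i j k = {T \<in> {..k} \<rightarrow>\<^sub>E {S. {i, j} \<subseteq> S \<and> S \<subseteq> {i..j}}. mono_on {..k} T}"

text \<open>
  The left adjoint of the homotopy coherent nerve sends \<open>X\<close> to the colimit, over the category of
  simplices of \<open>X\<close>, of the rigidifications of the standard simplices. In simplicial degree \<open>k\<close> this
  colimit of categories is presented by the generators \<open>(n, \<sigma>, i, j, T)\<close>, the image of the
  morphism \<open>T : i \<rightarrow> j\<close> under the leg belonging to the \<open>n\<close>-simplex \<open>\<sigma>\<close>, subject to the
  relations that the legs are functors and are compatible with the operators of the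
  simplex category. Words list the arrows of a path from first to last.
\<close>

type_synonym 'a gen = "nat \<times> 'a \<times> nat \<times> nat \<times> (nat \<Rightarrow> nat set)"

definition gens :: "'a sset \<Rightarrow> nat \<Rightarrow> 'a \<Rightarrow> 'a \<Rightarrow> 'a gen set" where
  "gens X k x y = {(n, \<sigma>, i, j, T). \<sigma> \<in> simp X n \<and> i \<le> j \<and> j \<le> n \<and> T \<in> chains i j k \<and>
     vertex X n i \<sigma> = x \<and> vertex X n j \<sigma> = y}"

inductive path :: "'a sset \<Rightarrow> nat \<Rightarrow> 'a \<Rightarrow> 'a \<Rightarrow> 'a gen list \<Rightarrow> bool" for X k where
  Nil: "x \<in> simp X 0 \<Longrightarrow> path X k x x []"
| Cons: "g \<in> gens X k x y \<Longrightarrow> path X k y z w \<Longrightarrow> path X k x z (g # w)"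

inductive rig_eq :: "'a sset \<Rightarrow> nat \<Rightarrow> 'a \<Rightarrow> 'a \<Rightarrow> 'a gen list \<Rightarrow> 'a gen list \<Rightarrow> bool" for X k where
  refl: "path X k x y w \<Longrightarrow> rig_eq X k x y w w"
| sym: "rig_eq X k x y w w' \<Longrightarrow> rig_eq X k x y w' w"
| trans: "rig_eq X k x y w w' \<Longrightarrow> rig_eq X k x y w' w'' \<Longrightarrow> rig_eq X k x y w w''"
| cong: "rig_eq X k x y u u' \<Longrightarrow> rig_eq X k y z v v' \<Longrightarrow> rig_eq X k x z (u @ v) (u' @ v')"
| ident: "\<sigma> \<in> simp X n \<Longrightarrow> i \<le> n \<Longrightarrow>
    rig_eq X k (vertex X n i \<sigma>) (vertex X n i \<sigma>) [(n, \<sigma>, i, i, \<lambda>r\<in>{..k}. {i})] []"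
| comp: "\<sigma> \<in> simp X n \<Longrightarrow> i \<le> j \<Longrightarrow> j \<le> l \<Longrightarrow> l \<le> n \<Longrightarrow> S \<in> chains i j k \<Longrightarrow> T \<in> chains j l k \<Longrightarrow>
    rig_eq X k (vertex X n i \<sigma>) (vertex X n l \<sigma>)
      [(n, \<sigma>, i, j, S), (n, \<sigma>, j, l, T)] [(n, \<sigma>, i, l, \<lambda>r\<in>{..k}. S r \<union> T r)]"
| nat: "\<sigma> \<in> simp X n \<Longrightarrow> \<alpha> \<in> delta m n \<Longrightarrow> i \<le> j \<Longrightarrow> j \<le> m \<Longrightarrow> T \<in> chains i j k \<Longrightarrow>
    rig_eq X k (vertex X n (\<alpha> i) \<sigma>) (vertex X n (\<alpha> j) \<sigma>)
      [(m, act X m n \<alpha> \<sigma>, i, j, T)] [(n, \<sigma>, \<alpha> i, \<alpha> j, \<lambda>r\<in>{..k}. \<alpha> ` T r)]"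

definition rig_class :: "'a sset \<Rightarrow> nat \<Rightarrow> 'a \<Rightarrow> 'a \<Rightarrow> 'a gen list \<Rightarrow> 'a gen list set" where
  "rig_class X k x y w = {w'. rig_eq X k x y w w'}"

definition rig_space :: "'a sset \<Rightarrow> 'a \<Rightarrow> 'a \<Rightarrow> 'a gen list set sset" where
  "rig_space X x y =
     \<lparr>simp = (\<lambda>k. {rig_class X k x y w |w. path X k x y w}),
      act = (\<lambda>l k \<beta> c. \<Union>w\<in>c. rig_class X l x y
               (map (\<lambda>(n, \<sigma>, i, j, T). (n, \<sigma>, i, j, compose {..l} T \<beta>)) w))\<rparr>"

definition rig :: "'a sset \<Rightarrow> ('a, 'a gen list set) scat" where
  "rig X = \<lparr>ob = simp X 0, mapsp = rig_space X, ident = (\<lambda>x. rig_class X 0 x x []),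
     cmp = (\<lambda>x y z k g f. \<Union>u\<in>f. \<Union>v\<in>g. rig_class X k x z (u @ v))\<rparr>"

definition rig_map ::
  "'a sset \<Rightarrow> 'b sset \<Rightarrow> (nat \<Rightarrow> 'a \<Rightarrow> 'b) \<Rightarrow>
   'a \<Rightarrow> 'a \<Rightarrow> nat \<Rightarrow> 'a gen list set \<Rightarrow> 'b gen list set" where
  "rig_map X Y f x y k = (\<lambda>c\<in>simp (rig_space X x y) k.
     \<Union>w\<in>c. rig_class Y k (f 0 x) (f 0 y) (map (\<lambda>(n, \<sigma>, i, j, T). (n, f n \<sigma>, i, j, T)) w))"

text \<open>The isomorphism from the rigidification of \<open>sop X\<close> to the opposite of the rigidification of
  \<open>X\<close>: on standard simplices it is induced by the reversal \<open>i \<mapsto> n - i\<close>.\<close>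

definition chi :: "'a sset \<Rightarrow> 'a \<Rightarrow> 'a \<Rightarrow> nat \<Rightarrow> 'a gen list set \<Rightarrow> 'a gen list set" where
  "chi X x y k = (\<lambda>c\<in>simp (rig_space (sop X) x y) k.
     \<Union>w\<in>c. rig_class X k y x
       (rev (map (\<lambda>(n, \<sigma>, i, j, T). (n, \<sigma>, n - j, n - i, \<lambda>r\<in>{..k}. (\<lambda>t. n - t) ` T r)) w)))"

definition rig_dagger :: "'a isset \<Rightarrow> ('a, 'a gen list set) dscat" where
  "rig_dagger X = scat.extend (rig (und X))
     (dscat.fields (\<lambda>x y k. compose (simp (rig_space (und X) x y) k)
        (chi (und X) x y k) (rig_map (und X) (sop (und X)) (inv_of X) x y k)))"

definition dagger_joyal_equiv ::
  "'a gen list set dscat01_functor \<Rightarrow> 'a gen list set dscat01_family \<Rightarrow>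
   'a isset \<Rightarrow> 'a isset \<Rightarrow> (nat \<Rightarrow> 'a \<Rightarrow> 'a) \<Rightarrow> bool" where
  "dagger_joyal_equiv R r X Y f \<longleftrightarrow>
     dagger_DK_equiv R r (rig_dagger X) (rig_dagger Y) (f 0) (rig_map (und X) (und Y) f)"

definition dagger_joyal_model ::
  "'a gen list set dscat01_functor \<Rightarrow> 'a gen list set dscat01_family \<Rightarrow>
   ('a isset, nat \<Rightarrow> 'a \<Rightarrow> 'a) model_classes" where
  "dagger_joyal_model R r = \<lparr>weq = dagger_joyal_equiv R r, cof = free_cofibration,
     fib = rlp sSet_dagger (\<lambda>A B f. free_cofibration A B f \<and> dagger_joyal_equiv R r A B f)\<rparr>"

end

theory Submission
  imports Defs "HOL-Library.Nat_Bijection"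
begin

text \<open>
  The inclusion \<open>qtag_star\<close> fails to preserve cofibrations because the two notions differ on
  vertices: a free cofibration may add vertices fixed by the dagger, a normal monomorphism may not.
  The inclusion of the empty object into the point separates them (\<open>free_not_normal\<close>). This rules
  out the second Quillen adjunction, and the restriction claim as well.

  The left adjoint \<open>qtag_shriek\<close> fails to preserve acyclic cofibrations because gluing each new
  vertex to its mirror image can create loops. Take two copies of the walking isomorphism between
  objects 0 and 1, exchanged by the involution, and the inclusion of the two objects 0. The
  involution is free, so this is a normal monomorphism, and each copy contracts onto its object 0,
  so it is a Joyal equivalence (\<open>twin_inclusion_joyal_equiv\<close>). The quotient identifies the two
  objects 0, and likewise the two objects 1. The source becomes a point, while the target becomes
  two isomorphisms glued along both ends, which has the homotopy type of a circle: going out along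
  one isomorphism and back along the other is a loop that is not homotopic to the identity.

  To see this loop in the rigidification, take the cocycle that counts the signed traversals of
  one of the copies. A cocycle assigns integers to the edges of simplices, additively along
  composable edges, and so adding up its values is compatible with all relations of
  the rigidification. Hence it separates components of the mapping spaces
  (\<open>cocycle_detects_non_equiv\<close>). Cocycles vanish on totally degenerate simplices, the only ones
  that the quotient identifies, so this one descends to it (\<open>cocycle_shriek\<close>). Thus the map of
  mapping spaces at the point is not bijective on components, and the image of the
  inclusion is not a dagger Joyal equivalence.

  Both adjunctions are established explicitly: equivariant maps preserve fixed vertices, and maps
  to an object with fixed vertices are constant on the classes of the vertex-orbit quotient.
\<close>

section \<open>Simplicial operators\<close>

(* keeps the operators \<lambda>_\<in>{..0}. i in the form in which vertex mentions them *)
declare atMost_0 [simp del]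

lemma deltaD: "\<alpha> \<in> delta m n \<Longrightarrow> i \<le> m \<Longrightarrow> \<alpha> i \<le> n"
  by (auto simp: delta_def)

lemma delta_const: "k \<le> n \<Longrightarrow> (\<lambda>_\<in>{..m}. k) \<in> delta m n"
  by (auto simp: delta_def mono_on_def)

lemma delta_id: "(\<lambda>i\<in>{..n}. i) \<in> delta n n"
  by (auto simp: delta_def mono_on_def)

lemma delta_compose: "\<beta> \<in> delta l m \<Longrightarrow> \<alpha> \<in> delta m n \<Longrightarrow> compose {..l} \<alpha> \<beta> \<in> delta l n"
  by (auto simp: delta_def mono_on_def compose_def Pi_iff PiE_iff)

lemma delta_reverse: "\<alpha> \<in> delta m n \<Longrightarrow> (\<lambda>i\<in>{..m}. n - \<alpha> (m - i)) \<in> delta m n"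
  by (auto simp: delta_def mono_on_def intro!: diff_le_mono2)

lemma compose_const: "i \<le> m \<Longrightarrow> compose {..l} \<alpha> (\<lambda>_\<in>{..l}. i) = (\<lambda>_\<in>{..l}. \<alpha> i)"
  by (auto simp: compose_def)

lemma compose_const_left:
  "\<beta> \<in> delta l m \<Longrightarrow> compose {..l} (\<lambda>_\<in>{..m}. k) \<beta> = (\<lambda>_\<in>{..l}. k)"
  by (auto simp: compose_def fun_eq_iff dest: deltaD)

lemma sset_act: "is_sset X \<Longrightarrow> \<alpha> \<in> delta m n \<Longrightarrow> s \<in> simp X n \<Longrightarrow> act X m n \<alpha> s \<in> simp X m"
  by (auto simp: is_sset_def)

lemma sset_id: "is_sset X \<Longrightarrow> s \<in> simp X n \<Longrightarrow> act X n n (\<lambda>i\<in>{..n}. i) s = s"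
  by (auto simp: is_sset_def)

lemma sset_compose:
  "is_sset X \<Longrightarrow> \<beta> \<in> delta l m \<Longrightarrow> \<alpha> \<in> delta m n \<Longrightarrow> s \<in> simp X n \<Longrightarrow>
    act X l m \<beta> (act X m n \<alpha> s) = act X l n (compose {..l} \<alpha> \<beta>) s"
  unfolding is_sset_def by metis

abbreviation degen :: "'a sset \<Rightarrow> nat \<Rightarrow> 'a \<Rightarrow> 'a" where
  "degen X n \<equiv> act X n 0 (\<lambda>_\<in>{..n}. 0)"

lemma degen_in: "is_sset X \<Longrightarrow> v \<in> simp X 0 \<Longrightarrow> degen X n v \<in> simp X n"
  by (simp add: sset_act delta_const)

lemma act_degen:
  "is_sset X \<Longrightarrow> \<alpha> \<in> delta m n \<Longrightarrow> v \<in> simp X 0 \<Longrightarrow> act X m n \<alpha> (degen X n v) = degen X m v"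
  by (simp add: sset_compose delta_const compose_const_left)

lemma degen_0: "is_sset X \<Longrightarrow> v \<in> simp X 0 \<Longrightarrow> degen X 0 v = v"
proof -
  have "(\<lambda>_\<in>{..0::nat}. 0::nat) = (\<lambda>i\<in>{..0}. i)" by auto
  then show "is_sset X \<Longrightarrow> v \<in> simp X 0 \<Longrightarrow> degen X 0 v = v" by (simp only: sset_id)
qed

lemma vertex_in: "is_sset X \<Longrightarrow> i \<le> n \<Longrightarrow> s \<in> simp X n \<Longrightarrow> vertex X n i s \<in> simp X 0"
  by (simp add: vertex_def sset_act delta_const)

lemma vertex_degen:
  "is_sset X \<Longrightarrow> i \<le> n \<Longrightarrow> v \<in> simp X 0 \<Longrightarrow> vertex X n i (degen X n v) = v"
  unfolding vertex_def by (simp add: act_degen delta_const degen_0)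

lemma vertex_act:
  "is_sset X \<Longrightarrow> \<alpha> \<in> delta m n \<Longrightarrow> i \<le> m \<Longrightarrow> s \<in> simp X n \<Longrightarrow>
    vertex X m i (act X m n \<alpha> s) = vertex X n (\<alpha> i) s"
  unfolding vertex_def by (simp add: sset_compose[OF _ delta_const] compose_const)

lemma smap_in: "f \<in> smaps X Y \<Longrightarrow> s \<in> simp X n \<Longrightarrow> f n s \<in> simp Y n"
  unfolding smaps_def by blast

lemma smap_act:
  "f \<in> smaps X Y \<Longrightarrow> \<alpha> \<in> delta m n \<Longrightarrow> s \<in> simp X n \<Longrightarrow> f m (act X m n \<alpha> s) = act Y m n \<alpha> (f n s)"
  unfolding smaps_def by blast

lemma smap_ext:
  assumes "f \<in> smaps X Y" "g \<in> smaps X Z" "\<And>n s. s \<in> simp X n \<Longrightarrow> f n s = g n s"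
  shows "f = g"
proof
  fix n
  have "f n \<in> simp X n \<rightarrow>\<^sub>E simp Y n" "g n \<in> simp X n \<rightarrow>\<^sub>E simp Z n"
    using assms(1,2) by (auto simp: smaps_def)
  then have "f n \<in> extensional (simp X n)" "g n \<in> extensional (simp X n)"
    by (auto simp: PiE_iff)
  then show "f n = g n" using assms(3) by (rule extensionalityI)
qed

lemma smapsI:
  assumes "\<And>n s. s \<in> simp X n \<Longrightarrow> F n s \<in> simp Y n"
    and "\<And>m n \<alpha> s. \<alpha> \<in> delta m n \<Longrightarrow> s \<in> simp X n \<Longrightarrow> act X m n \<alpha> s \<in> simp X m"
    and "\<And>m n \<alpha> s. \<alpha> \<in> delta m n \<Longrightarrow> s \<in> simp X n \<Longrightarrow>
      F m (act X m n \<alpha> s) = act Y m n \<alpha> (F n s)"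
  shows "(\<lambda>n. \<lambda>s\<in>simp X n. F n s) \<in> smaps X Y"
  using assms by (auto simp: smaps_def)

lemma smap_vertex:
  "f \<in> smaps X Y \<Longrightarrow> i \<le> n \<Longrightarrow> s \<in> simp X n \<Longrightarrow> f 0 (vertex X n i s) = vertex Y n i (f n s)"
  by (simp add: vertex_def smap_act delta_const)

lemma smap_degen: "f \<in> smaps X Y \<Longrightarrow> v \<in> simp X 0 \<Longrightarrow> f n (degen X n v) = degen Y n (f 0 v)"
  by (simp add: smap_act delta_const)

lemma scomp_apply: "s \<in> simp X n \<Longrightarrow> scomp X g f n s = g n (f n s)"
  by (simp add: scomp_def compose_def)

lemma scomp_in_smaps:
  assumes "is_sset X" "f \<in> smaps X Y" "g \<in> smaps Y Z"
  shows "scomp X g f \<in> smaps X Z"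
proof -
  have "(\<lambda>n. \<lambda>s\<in>simp X n. g n (f n s)) \<in> smaps X Z"
    using assms by (intro smapsI) (auto simp: sset_act smap_in smap_act)
  then show ?thesis by (simp add: scomp_def compose_def)
qed


section \<open>Anti-involutive simplicial sets\<close>

lemma AInv_sset: "is_AInv X \<Longrightarrow> is_sset (und X)"
  by (simp add: is_AInv_def)

lemma inv_in: "is_AInv X \<Longrightarrow> s \<in> simp (und X) n \<Longrightarrow> inv_of X n s \<in> simp (und X) n"
  by (auto simp: is_AInv_def sop_def dest!: smap_in)

lemma inv_inv: "is_AInv X \<Longrightarrow> s \<in> simp (und X) n \<Longrightarrow> inv_of X n (inv_of X n s) = s"
  by (simp add: is_AInv_def)

lemma inv_act:
  "is_AInv X \<Longrightarrow> \<alpha> \<in> delta m n \<Longrightarrow> s \<in> simp (und X) n \<Longrightarrow>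
    inv_of X m (act (und X) m n \<alpha> s) =
    act (und X) m n (\<lambda>i\<in>{..m}. n - \<alpha> (m - i)) (inv_of X n s)"
  by (auto simp: is_AInv_def sop_def dest!: smap_act)

lemma inv_degen:
  assumes "is_AInv X" "v \<in> simp (und X) 0"
  shows "inv_of X n (degen (und X) n v) = degen (und X) n (inv_of X 0 v)"
proof -
  have "(\<lambda>i\<in>{..n}. 0 - (\<lambda>_\<in>{..n}. 0::nat) (n - i)) = (\<lambda>_\<in>{..n}. 0)" by auto
  then show ?thesis using assms by (simp add: inv_act delta_const)
qed

lemma vertex_inv:
  assumes "is_AInv X" "s \<in> simp (und X) n" "i \<le> n"
  shows "vertex (und X) n i (inv_of X n s) = inv_of X 0 (vertex (und X) n (n - i) s)"
proof -
  have "(\<lambda>j\<in>{..0}. n - (\<lambda>_\<in>{..0}. n - i) (0 - j)) = (\<lambda>_\<in>{..0::nat}. i)"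
    using assms(3) by auto
  then show ?thesis using assms by (simp add: vertex_def inv_act delta_const)
qed

lemma is_AInvI:
  assumes "is_sset U"
    and "\<And>n s. s \<in> simp U n \<Longrightarrow> t n s \<in> simp U n"
    and "\<And>n s. s \<in> simp U n \<Longrightarrow> t n (t n s) = s"
    and "\<And>m n \<alpha> s. \<alpha> \<in> delta m n \<Longrightarrow> s \<in> simp U n \<Longrightarrow>
      t m (act U m n \<alpha> s) = act U m n (\<lambda>i\<in>{..m}. n - \<alpha> (m - i)) (t n s)"
  shows "is_AInv \<lparr>und = U, inv_of = (\<lambda>n. \<lambda>s\<in>simp U n. t n s)\<rparr>"
proof -
  have "(\<lambda>n. \<lambda>s\<in>simp U n. t n s) \<in> smaps U (sop U)"
    using assms by (intro smapsI) (auto simp: sop_def sset_act)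
  then show ?thesis using assms by (simp add: is_AInv_def)
qed

lemma equivariant_smap: "f \<in> equivariant_maps X Y \<Longrightarrow> f \<in> smaps (und X) (und Y)"
  by (simp add: equivariant_maps_def)

lemma equivariant_inv:
  "f \<in> equivariant_maps X Y \<Longrightarrow> s \<in> simp (und X) n \<Longrightarrow> f n (inv_of X n s) = inv_of Y n (f n s)"
  by (simp add: equivariant_maps_def)

lemma dagger_AInv: "is_dagger X \<Longrightarrow> is_AInv X"
  by (simp add: is_dagger_def)

lemma star_functor: "is_functor sSet_dagger sSet_AInv qtag_star"
  by (simp add: is_functor_def qtag_star_def sSet_dagger_def sSet_AInv_def is_dagger_def)


section \<open>The fixed-vertex part as right adjoint\<close>

abbreviation fixed_part :: "'a isset \<Rightarrow> 'a isset" where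
  "fixed_part \<equiv> fst qtag_lower_star"

lemma fixed_part_simps [simp]:
  "simp (und (fixed_part X)) = fixed_simp X"
  "act (und (fixed_part X)) = act (und X)"
  "inv_of (fixed_part X) n = restrict (inv_of X n) (fixed_simp X n)"
  by (simp_all add: qtag_lower_star_def)

lemma fixed_simp_sub: "s \<in> fixed_simp X n \<Longrightarrow> s \<in> simp (und X) n"
  by (simp add: fixed_simp_def)

lemma fixed_simp_act:
  "is_AInv X \<Longrightarrow> \<alpha> \<in> delta m n \<Longrightarrow> s \<in> fixed_simp X n \<Longrightarrow> act (und X) m n \<alpha> s \<in> fixed_simp X m"
  by (auto simp: fixed_simp_def sset_act AInv_sset vertex_act deltaD)

lemma fixed_simp_inv:
  "is_AInv X \<Longrightarrow> s \<in> fixed_simp X n \<Longrightarrow> inv_of X n s \<in> fixed_simp X n"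
  by (auto simp: fixed_simp_def inv_in vertex_inv)

lemma fixed_simp_map:
  assumes "f \<in> equivariant_maps X Y" "is_AInv X" "s \<in> fixed_simp X n"
  shows "f n s \<in> fixed_simp Y n"
proof -
  have f: "f \<in> smaps (und X) (und Y)" by (rule equivariant_smap[OF assms(1)])
  have "inv_of Y 0 (f 0 v) = f 0 (inv_of X 0 v)" if "v \<in> simp (und X) 0" for v
    using equivariant_inv[OF assms(1) that] by simp
  then show ?thesis
    using assms(3) vertex_in[OF AInv_sset[OF assms(2)]]
    by (auto simp: fixed_simp_def smap_in[OF f] simp flip: smap_vertex[OF f])
qed

lemma fixed_simp_dagger: "is_dagger X \<Longrightarrow> fixed_simp X n = simp (und X) n"
  by (auto simp: fixed_simp_def is_dagger_def AInv_sset vertex_in)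

lemma fixed_part_dagger:
  assumes X: "is_AInv X"
  shows "is_dagger (fixed_part X)"
proof -
  let ?U = "\<lparr>simp = fixed_simp X, act = act (und X)\<rparr>"
  have U: "is_sset ?U"
    using AInv_sset[OF X] fixed_simp_act[OF X]
    unfolding is_sset_def by (auto dest!: fixed_simp_sub)
  have "is_AInv \<lparr>und = ?U, inv_of = (\<lambda>n. \<lambda>s\<in>simp ?U n. inv_of X n s)\<rparr>"
    using X by (intro is_AInvI U) (auto simp: fixed_simp_inv fixed_simp_sub inv_inv inv_act)
  moreover have "inv_of X 0 v = v" if "v \<in> fixed_simp X 0" for v
  proof -
    have "vertex (und X) 0 0 v = v"
      using degen_0[OF AInv_sset[OF X] fixed_simp_sub[OF that]] by (simp add: vertex_def)
    then show ?thesis using that by (auto simp: fixed_simp_def)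
  qed
  ultimately show ?thesis by (simp add: is_dagger_def qtag_lower_star_def)
qed

lemma lower_star_functor: "is_functor sSet_AInv sSet_dagger qtag_lower_star"
proof -
  have hom: "(\<lambda>n. restrict (f n) (fixed_simp X n)) \<in> equivariant_maps (fixed_part X) (fixed_part Y)"
    if X: "is_AInv X" and f: "f \<in> equivariant_maps X Y" for X Y :: "'a isset" and f
  proof -
    have "(\<lambda>n. \<lambda>s\<in>simp (und (fixed_part X)) n. f n s) \<in>
        smaps (und (fixed_part X)) (und (fixed_part Y))"
      using X f equivariant_smap[OF f]
      by (intro smapsI) (auto simp: fixed_simp_map fixed_simp_act smap_act dest: fixed_simp_sub)
    then show ?thesis
      using X f by (auto simp: equivariant_maps_def fixed_simp_inv fixed_simp_map fixed_simp_sub)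
  qed
  show ?thesis
    unfolding is_functor_def
  proof (intro conjI ballI)
    fix X :: "'a isset" assume X: "X \<in> Obj sSet_AInv"
    then have X': "is_AInv X" by (simp add: sSet_AInv_def)
    show "fixed_part X \<in> Obj sSet_dagger"
      using fixed_part_dagger[OF X'] by (simp add: sSet_dagger_def)
    show "snd qtag_lower_star X X (Idn sSet_AInv X) = Idn sSet_dagger (fixed_part X)"
      by (auto simp: qtag_lower_star_def sSet_AInv_def sSet_dagger_def sid_def fun_eq_iff
          dest: fixed_simp_sub)
    fix Y :: "'a isset" and f assume Y: "Y \<in> Obj sSet_AInv" and f: "f \<in> Hom sSet_AInv X Y"
    have f': "f \<in> equivariant_maps X Y" using f by (simp add: sSet_AInv_def)
    show "snd qtag_lower_star X Y f \<in> Hom sSet_dagger (fixed_part X) (fixed_part Y)"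
      using hom[OF X' f'] by (simp add: sSet_dagger_def qtag_lower_star_def)
    fix Z :: "'a isset" and g
    show "snd qtag_lower_star X Z (Cmp sSet_AInv X Y Z g f) =
      Cmp sSet_dagger (fixed_part X) (fixed_part Y) (fixed_part Z)
        (snd qtag_lower_star Y Z g) (snd qtag_lower_star X Y f)"
      using fixed_simp_map[OF f' X']
      by (auto simp: qtag_lower_star_def sSet_AInv_def sSet_dagger_def scomp_def compose_def
          fun_eq_iff dest: fixed_simp_sub)
  qed
qed

text \<open>An equivariant map sends fixed vertices to fixed vertices, so out of a dagger object it lands
  in the fixed part by itself: the adjunction bijection is an equality of hom-sets.\<close>

lemma maps_to_fixed_part:
  assumes X: "is_dagger X" and Y: "is_AInv Y"
  shows "equivariant_maps X (fixed_part Y) = equivariant_maps X Y"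
proof (intro equalityI subsetI)
  fix f assume f: "f \<in> equivariant_maps X Y"
  have "f n s \<in> fixed_simp Y n" if "s \<in> simp (und X) n" for n s
    using fixed_simp_map[OF f dagger_AInv[OF X]] that fixed_simp_dagger[OF X] by blast
  then show "f \<in> equivariant_maps X (fixed_part Y)"
    using f by (auto simp: equivariant_maps_def smaps_def PiE_iff)
next
  fix f assume f: "f \<in> equivariant_maps X (fixed_part Y)"
  have m: "f n s \<in> fixed_simp Y n" if "s \<in> simp (und X) n" for n s
    using smap_in[OF equivariant_smap[OF f] that] by simp
  have "f n s \<in> simp (und Y) n" if "s \<in> simp (und X) n" for n s
    using m[OF that] by (rule fixed_simp_sub)
  then show "f \<in> equivariant_maps X Y"
    using f m by (auto simp: equivariant_maps_def smaps_def PiE_iff)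
qed

lemma star_lower_star_adjunction:
  "adjunction sSet_dagger sSet_AInv qtag_star qtag_lower_star"
  unfolding adjunction_def
proof (intro conjI star_functor lower_star_functor exI[of _ "\<lambda>X Y g. g"] ballI)
  fix X Y :: "'a isset" assume "X \<in> Obj sSet_dagger" and "Y \<in> Obj sSet_AInv"
  then have "is_dagger X" "is_AInv Y" by (simp_all add: sSet_dagger_def sSet_AInv_def)
  then show "bij_betw (\<lambda>g. g) (Hom sSet_AInv (fst qtag_star X) Y) (Hom sSet_dagger X (fixed_part Y))"
    by (simp add: bij_betw_def sSet_dagger_def sSet_AInv_def qtag_star_def maps_to_fixed_part)
next
  fix X Y Y' :: "'a isset" and g k
  assume "X \<in> Obj sSet_dagger" "Y \<in> Obj sSet_AInv" and g: "g \<in> Hom sSet_AInv (fst qtag_star X) Y"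
  then have "is_dagger X" "is_AInv Y" by (simp_all add: sSet_dagger_def sSet_AInv_def)
  moreover have "g \<in> equivariant_maps X Y" using g by (simp add: sSet_AInv_def qtag_star_def)
  ultimately have "g \<in> equivariant_maps X (fixed_part Y)" by (simp add: maps_to_fixed_part)
  then have "g n s \<in> fixed_simp Y n" if "s \<in> simp (und X) n" for n s
    using smap_in[OF equivariant_smap that] by fastforce
  then show "Cmp sSet_AInv (fst qtag_star X) Y Y' k g =
    Cmp sSet_dagger X (fixed_part Y) (fixed_part Y') (snd qtag_lower_star Y Y' k) g"
    by (auto simp: sSet_AInv_def sSet_dagger_def qtag_star_def qtag_lower_star_def scomp_def
        compose_def fun_eq_iff)
next
  fix X' X Y :: "'a isset" and g h
  show "Cmp sSet_AInv (fst qtag_star X') (fst qtag_star X) Y g (snd qtag_star X' X h) =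
    Cmp sSet_dagger X' X (fixed_part Y) g h"
    by (simp add: sSet_AInv_def sSet_dagger_def qtag_star_def)
qed


section \<open>The vertex-orbit quotient as left adjoint\<close>

text \<open>Only totally degenerate simplices are identified, so this relation is already the
  simplicial equivalence relation generated by \<open>v \<sim> inv_of X 0 v\<close> on vertices.\<close>

definition tag_eq :: "'a isset \<Rightarrow> nat \<Rightarrow> 'a \<Rightarrow> 'a \<Rightarrow> bool" where
  "tag_eq X n s t \<longleftrightarrow> s = t \<or>
     (\<exists>v\<in>simp (und X) 0. s = degen (und X) n v \<and> t = degen (und X) n (inv_of X 0 v))"

lemma tag_eq_act:
  assumes "is_AInv X" "\<alpha> \<in> delta m n" "tag_eq X n s t"
  shows "tag_eq X m (act (und X) m n \<alpha> s) (act (und X) m n \<alpha> t)"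
  using assms by (auto simp: tag_eq_def act_degen AInv_sset inv_in)

lemma tag_eq_inv:
  assumes "is_AInv X" "tag_eq X n s t"
  shows "tag_eq X n (inv_of X n s) (inv_of X n t)"
  using assms inv_in[OF assms(1)] by (fastforce simp: tag_eq_def inv_degen)

lemma tag_eq_map:
  assumes "is_AInv X" "f \<in> equivariant_maps X Y" "tag_eq X n s t"
  shows "tag_eq Y n (f n s) (f n t)"
  using assms(3) smap_in[OF equivariant_smap[OF assms(2)]]
  by (auto simp: tag_eq_def smap_degen[OF equivariant_smap[OF assms(2)]] inv_in[OF assms(1)]
      equivariant_inv[OF assms(2)])

lemma tag_eq_dagger: "is_dagger X \<Longrightarrow> tag_eq X n s t \<Longrightarrow> s = t"
  by (auto simp: tag_eq_def is_dagger_def)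

lemma tag_eq_rep:
  assumes X: "is_AInv X" and s: "s \<in> simp (und X) n"
  shows "tag_eq X n s (tag_rep X n s)"
proof -
  define v where "v = vertex (und X) n 0 s"
  define w where "w = (SOME w. w \<in> {v, inv_of X 0 v})"
  have v: "v \<in> simp (und X) 0" using X s by (simp add: v_def vertex_in AInv_sset)
  have "\<exists>w. w \<in> {v, inv_of X 0 v}" by blast
  then have "w \<in> {v, inv_of X 0 v}" unfolding w_def by (rule someI_ex)
  moreover have "tag_rep X n s = (if s = degen (und X) n v then degen (und X) n w else s)"
    by (simp add: tag_rep_def Let_def v_def w_def)
  ultimately show ?thesis using v by (auto simp: tag_eq_def)
qed

lemma tag_eq_in:
  assumes "is_AInv X" "s \<in> simp (und X) n" "tag_eq X n s t"
  shows "t \<in> simp (und X) n"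
  using assms by (auto simp: tag_eq_def degen_in AInv_sset inv_in)

lemma tag_rep_in:
  "is_AInv X \<Longrightarrow> s \<in> simp (und X) n \<Longrightarrow> tag_rep X n s \<in> simp (und X) n"
  by (rule tag_eq_in[OF _ _ tag_eq_rep])

text \<open>The choice in \<open>tag_rep\<close> is made from the unordered orbit of a vertex; here the involutivity
  of \<open>inv_of\<close> makes the two orbits coincide. Together with \<open>tag_eq_rep\<close> this makes \<open>tag_rep\<close> a
  normal form for \<open>tag_eq\<close>, and each structure map descends because it respects \<open>tag_eq\<close>.\<close>

lemma tag_rep_cong:
  assumes X: "is_AInv X" and "tag_eq X n s t"
  shows "tag_rep X n s = tag_rep X n t"
proof -
  have "tag_rep X n (degen (und X) n v) = tag_rep X n (degen (und X) n (inv_of X 0 v))"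
    if v: "v \<in> simp (und X) 0" for v
    using X v by (simp add: tag_rep_def Let_def vertex_degen AInv_sset inv_in inv_inv insert_commute)
  then show ?thesis using assms(2) by (auto simp: tag_eq_def)
qed

lemma tag_rep_idem:
  "is_AInv X \<Longrightarrow> s \<in> simp (und X) n \<Longrightarrow> tag_rep X n (tag_rep X n s) = tag_rep X n s"
  by (rule tag_rep_cong[OF _ tag_eq_rep, symmetric])

lemma tag_rep_act:
  assumes "is_AInv X" "\<alpha> \<in> delta m n" "s \<in> simp (und X) n"
  shows "tag_rep X m (act (und X) m n \<alpha> (tag_rep X n s)) = tag_rep X m (act (und X) m n \<alpha> s)"
  using tag_rep_cong[OF assms(1) tag_eq_act[OF assms(1,2) tag_eq_rep[OF assms(1,3)]]] by simp

lemma tag_rep_inv: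
  assumes "is_AInv X" "s \<in> simp (und X) n"
  shows "tag_rep X n (inv_of X n (tag_rep X n s)) = tag_rep X n (inv_of X n s)"
  using tag_rep_cong[OF assms(1) tag_eq_inv[OF assms(1) tag_eq_rep[OF assms]]] by simp

lemma tag_rep_map:
  assumes "is_AInv X" "is_AInv Y" "f \<in> equivariant_maps X Y" "s \<in> simp (und X) n"
  shows "tag_rep Y n (f n (tag_rep X n s)) = tag_rep Y n (f n s)"
  using tag_rep_cong[OF assms(2) tag_eq_map[OF assms(1,3) tag_eq_rep[OF assms(1,4)]]] by simp

lemma map_tag_rep_dagger:
  assumes "is_AInv X" "is_dagger Y" "f \<in> equivariant_maps X Y" "s \<in> simp (und X) n"
  shows "f n (tag_rep X n s) = f n s"
  using tag_eq_dagger[OF assms(2) tag_eq_map[OF assms(1,3) tag_eq_rep[OF assms(1,4)]]] by simp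

lemma shriek_simps [simp]:
  "simp (und (qtag_shriek_ob X)) n = tag_rep X n ` simp (und X) n"
  "act (und (qtag_shriek_ob X)) m n \<alpha> s = tag_rep X m (act (und X) m n \<alpha> s)"
  "inv_of (qtag_shriek_ob X) n =
    (\<lambda>s\<in>tag_rep X n ` simp (und X) n. tag_rep X n (inv_of X n s))"
  by (simp_all add: qtag_shriek_ob_def)

lemma shriek_sset:
  assumes X: "is_AInv X"
  shows "is_sset (und (qtag_shriek_ob X))"
  unfolding is_sset_def
proof (intro conjI allI ballI)
  fix m n \<alpha> s
  assume "\<alpha> \<in> delta m n" and s: "s \<in> simp (und (qtag_shriek_ob X)) n"
  then show "act (und (qtag_shriek_ob X)) m n \<alpha> s \<in> simp (und (qtag_shriek_ob X)) m"
    using X by (auto simp: sset_act AInv_sset tag_rep_in)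
next
  fix n s assume "s \<in> simp (und (qtag_shriek_ob X)) n"
  then show "act (und (qtag_shriek_ob X)) n n (\<lambda>i\<in>{..n}. i) s = s"
    using X by (auto simp: sset_id AInv_sset tag_rep_in tag_rep_idem)
next
  fix l m n \<beta> \<alpha> s
  assume "\<beta> \<in> delta l m" "\<alpha> \<in> delta m n" "s \<in> simp (und (qtag_shriek_ob X)) n"
  then show "act (und (qtag_shriek_ob X)) l n (compose {..l} \<alpha> \<beta>) s =
      act (und (qtag_shriek_ob X)) l m \<beta> (act (und (qtag_shriek_ob X)) m n \<alpha> s)"
    using X by (auto simp: tag_rep_act tag_rep_in sset_act AInv_sset sset_compose delta_compose)
qed

lemma shriek_dagger:
  assumes X: "is_AInv X"
  shows "is_dagger (qtag_shriek_ob X)"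
proof -
  let ?Q = "und (qtag_shriek_ob X)"
  have "is_AInv \<lparr>und = ?Q, inv_of = (\<lambda>n. \<lambda>s\<in>simp ?Q n. tag_rep X n (inv_of X n s))\<rparr>"
    using X
    by (intro is_AInvI shriek_sset)
      (auto simp: inv_in tag_rep_in tag_rep_inv tag_rep_idem inv_inv tag_rep_act inv_act
        sset_act AInv_sset delta_reverse)
  moreover have "\<lparr>und = ?Q, inv_of = (\<lambda>n. \<lambda>s\<in>simp ?Q n. tag_rep X n (inv_of X n s))\<rparr> =
      qtag_shriek_ob X"
    by (simp add: qtag_shriek_ob_def)
  moreover have "inv_of (qtag_shriek_ob X) 0 v = v" if v0: "v \<in> simp ?Q 0" for v
  proof -
    obtain u where u: "u \<in> simp (und X) 0" and v: "v = tag_rep X 0 u" using v0 by auto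
    have "tag_eq X 0 u (inv_of X 0 u)"
      using X u by (auto simp: tag_eq_def degen_0 AInv_sset inv_in)
    then have "tag_rep X 0 u = tag_rep X 0 (inv_of X 0 u)" by (rule tag_rep_cong[OF X])
    moreover have "inv_of (qtag_shriek_ob X) 0 v = tag_rep X 0 (inv_of X 0 u)"
      using X u v0 by (simp add: v tag_rep_inv)
    ultimately show ?thesis by (simp add: v)
  qed
  ultimately show ?thesis by (simp add: is_dagger_def)
qed

lemma shriek_hom:
  assumes X: "is_AInv X" and Y: "is_AInv Y" and f: "f \<in> equivariant_maps X Y"
  shows "snd qtag_shriek X Y f \<in> equivariant_maps (qtag_shriek_ob X) (qtag_shriek_ob Y)"
proof -
  note f' = equivariant_smap[OF f]
  have "(\<lambda>n. \<lambda>s\<in>simp (und (qtag_shriek_ob X)) n. tag_rep Y n (f n s))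
      \<in> smaps (und (qtag_shriek_ob X)) (und (qtag_shriek_ob Y))"
    using X Y
    by (intro smapsI)
      (auto simp: tag_rep_in smap_in[OF f'] sset_act AInv_sset tag_rep_map[OF X Y f]
        tag_rep_act smap_act[OF f'])
  then show ?thesis
    using X Y
    by (auto simp: equivariant_maps_def qtag_shriek_def inv_in tag_rep_in tag_rep_map[OF X Y f]
        tag_rep_inv smap_in[OF f'] equivariant_inv[OF f] tag_rep_idem)
qed

lemma shriek_functor: "is_functor sSet_AInv sSet_dagger qtag_shriek"
  unfolding is_functor_def
proof (intro conjI ballI)
  fix X :: "'a isset" assume "X \<in> Obj sSet_AInv"
  then have X: "is_AInv X" by (simp add: sSet_AInv_def)
  show "fst qtag_shriek X \<in> Obj sSet_dagger"
    using shriek_dagger[OF X] by (simp add: sSet_dagger_def qtag_shriek_def)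
  show "snd qtag_shriek X X (Idn sSet_AInv X) = Idn sSet_dagger (fst qtag_shriek X)"
    using X by (auto simp: qtag_shriek_def sSet_AInv_def sSet_dagger_def sid_def fun_eq_iff
        tag_rep_in tag_rep_idem)
  fix Y :: "'a isset" and f assume "Y \<in> Obj sSet_AInv" "f \<in> Hom sSet_AInv X Y"
  then have Y: "is_AInv Y" and f: "f \<in> equivariant_maps X Y" by (simp_all add: sSet_AInv_def)
  show "snd qtag_shriek X Y f \<in> Hom sSet_dagger (fst qtag_shriek X) (fst qtag_shriek Y)"
    using shriek_hom[OF X Y f] by (simp add: sSet_dagger_def qtag_shriek_def)
  fix Z :: "'a isset" and g assume "Z \<in> Obj sSet_AInv" "g \<in> Hom sSet_AInv Y Z"
  then have Z: "is_AInv Z" and g: "g \<in> equivariant_maps Y Z" by (simp_all add: sSet_AInv_def)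
  show "snd qtag_shriek X Z (Cmp sSet_AInv X Y Z g f) =
    Cmp sSet_dagger (fst qtag_shriek X) (fst qtag_shriek Y) (fst qtag_shriek Z)
      (snd qtag_shriek Y Z g) (snd qtag_shriek X Y f)"
    using X Y smap_in[OF equivariant_smap[OF f]]
    by (auto simp: qtag_shriek_def sSet_AInv_def sSet_dagger_def scomp_def compose_def fun_eq_iff
        tag_rep_in tag_rep_map[OF Y Z g])
qed

abbreviation shriek_transpose :: "'a isset \<Rightarrow> (nat \<Rightarrow> 'a \<Rightarrow> 'a) \<Rightarrow> nat \<Rightarrow> 'a \<Rightarrow> 'a" where
  "shriek_transpose X g \<equiv> (\<lambda>n. \<lambda>s\<in>simp (und X) n. g n (tag_rep X n s))"

lemma shriek_transpose_hom:
  assumes X: "is_AInv X" and g: "g \<in> equivariant_maps (qtag_shriek_ob X) Y"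
  shows "shriek_transpose X g \<in> equivariant_maps X Y"
proof -
  note g' = equivariant_smap[OF g]
  have act: "g m (tag_rep X m (act (und X) m n \<alpha> s)) = act (und Y) m n \<alpha> (g n (tag_rep X n s))"
    if "\<alpha> \<in> delta m n" "s \<in> simp (und X) n" for m n \<alpha> s
    using smap_act[OF g', of \<alpha> m n "tag_rep X n s"] that by (simp add: tag_rep_act[OF X])
  have inv: "g n (tag_rep X n (inv_of X n s)) = inv_of Y n (g n (tag_rep X n s))"
    if "s \<in> simp (und X) n" for n s
    using equivariant_inv[OF g, of "tag_rep X n s" n] that by (simp add: tag_rep_inv[OF X])
  have "shriek_transpose X g \<in> smaps (und X) (und Y)"
    using X by (intro smapsI) (auto simp: smap_in[OF g'] sset_act AInv_sset act)
  then show ?thesis using X by (simp add: equivariant_maps_def inv_in inv)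
qed

lemma shriek_transpose_bij:
  assumes X: "is_AInv X" and Y: "is_dagger Y"
  shows "bij_betw (shriek_transpose X) (equivariant_maps (qtag_shriek_ob X) Y) (equivariant_maps X Y)"
proof (rule bij_betw_byWitness
    [of _ "\<lambda>h n. \<lambda>s\<in>simp (und (qtag_shriek_ob X)) n. h n s"])
  show "\<forall>g\<in>equivariant_maps (qtag_shriek_ob X) Y.
      (\<lambda>n. \<lambda>s\<in>simp (und (qtag_shriek_ob X)) n. shriek_transpose X g n s) = g"
  proof
    fix g assume g: "g \<in> equivariant_maps (qtag_shriek_ob X) Y"
    have "(\<lambda>n. \<lambda>s\<in>simp (und (qtag_shriek_ob X)) n. g n s) = g"
      using equivariant_smap[OF g] unfolding smaps_def by (force simp: fun_eq_iff PiE_iff extensional_def)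
    moreover have "(\<lambda>s\<in>simp (und (qtag_shriek_ob X)) n. shriek_transpose X g n s) =
        (\<lambda>s\<in>simp (und (qtag_shriek_ob X)) n. g n s)" for n
      using X by (auto simp: tag_rep_in tag_rep_idem fun_eq_iff)
    ultimately show "(\<lambda>n. \<lambda>s\<in>simp (und (qtag_shriek_ob X)) n. shriek_transpose X g n s) = g"
      by simp
  qed
  show "\<forall>h\<in>equivariant_maps X Y.
      shriek_transpose X (\<lambda>n. \<lambda>s\<in>simp (und (qtag_shriek_ob X)) n. h n s) = h"
  proof
    fix h assume h: "h \<in> equivariant_maps X Y"
    have "(\<lambda>n. \<lambda>s\<in>simp (und X) n. h n s) = h"
      using equivariant_smap[OF h] unfolding smaps_def by (force simp: fun_eq_iff PiE_iff extensional_def)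
    moreover have "shriek_transpose X (\<lambda>n. \<lambda>s\<in>simp (und (qtag_shriek_ob X)) n. h n s) =
        (\<lambda>n. \<lambda>s\<in>simp (und X) n. h n s)"
      using map_tag_rep_dagger[OF X Y h] by (auto simp: fun_eq_iff)
    ultimately show "shriek_transpose X (\<lambda>n. \<lambda>s\<in>simp (und (qtag_shriek_ob X)) n. h n s) = h"
      by simp
  qed
  show "shriek_transpose X ` equivariant_maps (qtag_shriek_ob X) Y \<subseteq> equivariant_maps X Y"
    using shriek_transpose_hom[OF X] by blast
  show "(\<lambda>h n. \<lambda>s\<in>simp (und (qtag_shriek_ob X)) n. h n s) ` equivariant_maps X Y
      \<subseteq> equivariant_maps (qtag_shriek_ob X) Y"
  proof (intro image_subsetI)
    fix h assume h: "h \<in> equivariant_maps X Y"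
    note h' = equivariant_smap[OF h]
    have "(\<lambda>n. \<lambda>s\<in>simp (und (qtag_shriek_ob X)) n. h n s) \<in> smaps (und (qtag_shriek_ob X)) (und Y)"
      using X
      by (intro smapsI) (auto simp: tag_rep_in smap_in[OF h'] sset_act AInv_sset
          map_tag_rep_dagger[OF X Y h] tag_rep_act smap_act[OF h'])
    then show "(\<lambda>n. \<lambda>s\<in>simp (und (qtag_shriek_ob X)) n. h n s)
        \<in> equivariant_maps (qtag_shriek_ob X) Y"
      using X by (auto simp: equivariant_maps_def map_tag_rep_dagger[OF X Y h] tag_rep_inv inv_in
          equivariant_inv[OF h] tag_rep_in)
  qed
qed

lemma shriek_star_adjunction: "adjunction sSet_AInv sSet_dagger qtag_shriek qtag_star"
  unfolding adjunction_def
proof (intro conjI star_functor shriek_functor exI[of _ "\<lambda>X Y. shriek_transpose X"] ballI)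
  fix X Y :: "'a isset" assume "X \<in> Obj sSet_AInv" and "Y \<in> Obj sSet_dagger"
  then have "is_AInv X" "is_dagger Y" by (simp_all add: sSet_dagger_def sSet_AInv_def)
  then show "bij_betw (shriek_transpose X) (Hom sSet_dagger (fst qtag_shriek X) Y)
      (Hom sSet_AInv X (fst qtag_star Y))"
    using shriek_transpose_bij by (simp add: sSet_dagger_def sSet_AInv_def qtag_star_def qtag_shriek_def)
next
  fix X Y Y' :: "'a isset" and g k
  assume "X \<in> Obj sSet_AInv"
  then show "shriek_transpose X (Cmp sSet_dagger (fst qtag_shriek X) Y Y' k g) =
    Cmp sSet_AInv X (fst qtag_star Y) (fst qtag_star Y') (snd qtag_star Y Y' k) (shriek_transpose X g)"
    by (auto simp: sSet_AInv_def sSet_dagger_def qtag_star_def qtag_shriek_def scomp_def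
        compose_def fun_eq_iff tag_rep_in)
next
  fix X' X Y :: "'a isset" and g h
  assume "X' \<in> Obj sSet_AInv" "X \<in> Obj sSet_AInv" "h \<in> Hom sSet_AInv X' X"
  then have X': "is_AInv X'" and X: "is_AInv X" and h: "h \<in> equivariant_maps X' X"
    by (simp_all add: sSet_AInv_def)
  show "shriek_transpose X' (Cmp sSet_dagger (fst qtag_shriek X') (fst qtag_shriek X) Y g
      (snd qtag_shriek X' X h)) =
    Cmp sSet_AInv X' X (fst qtag_star Y) (shriek_transpose X g) h"
    using smap_in[OF equivariant_smap[OF h]]
    by (auto simp: sSet_AInv_def sSet_dagger_def qtag_star_def qtag_shriek_def scomp_def
        compose_def fun_eq_iff tag_rep_map[OF X' X h])
qed


section \<open>Cofibrations are not preserved by the inclusion\<close>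

definition empty_isset :: "'a isset" where
  "empty_isset = \<lparr>und = \<lparr>simp = (\<lambda>_. {}), act = (\<lambda>m n \<alpha> s. s)\<rparr>, inv_of = (\<lambda>n. \<lambda>s\<in>{}. s)\<rparr>"

definition point_isset :: "'a \<Rightarrow> 'a isset" where
  "point_isset p = \<lparr>und = discrete {p}, inv_of = (\<lambda>n. \<lambda>s\<in>{p}. s)\<rparr>"

lemma empty_dagger: "is_dagger empty_isset"
  by (simp add: is_dagger_def is_AInv_def is_sset_def empty_isset_def smaps_def sop_def fun_eq_iff)

lemma point_dagger: "is_dagger (point_isset p)"
  by (simp add: is_dagger_def is_AInv_def is_sset_def point_isset_def smaps_def sop_def discrete_def fun_eq_iff)

text \<open>The vertex of the point is nondegenerate and fixed. Freeness is demanded of it by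
  \<open>normal_mono\<close> but not by \<open>free_cofibration\<close>, and in positive dimensions the point has only
  degenerate simplices.\<close>

lemma free_not_normal:
  "\<exists>(X :: 'a isset)\<in>Obj sSet_dagger. \<exists>Y\<in>Obj sSet_dagger. \<exists>f\<in>Hom sSet_dagger X Y.
     free_cofibration X Y f \<and> \<not> normal_mono X Y f"
proof -
  let ?X = "empty_isset :: 'a isset" and ?Y = "point_isset (undefined :: 'a)"
  let ?f = "\<lambda>n. \<lambda>s\<in>{}. s :: 'a"
  have ob: "?X \<in> Obj sSet_dagger" "?Y \<in> Obj sSet_dagger"
    by (simp_all add: sSet_dagger_def empty_dagger point_dagger)
  have hom: "?f \<in> Hom sSet_dagger ?X ?Y"
    by (simp add: sSet_dagger_def equivariant_maps_def smaps_def empty_isset_def fun_eq_iff)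
  have "\<not> nondegenerate (und ?Y) n s" if "n > 0" for n s
    using that delta_const[of 0 0 n]
    by (auto simp: nondegenerate_def point_isset_def discrete_def)
  then have free: "free_cofibration ?X ?Y ?f"
    by (auto simp: free_cofibration_def smono_def empty_isset_def)
  have "nondegenerate (und ?Y) 0 undefined"
    by (simp add: nondegenerate_def point_isset_def discrete_def)
  then have "\<not> normal_mono ?X ?Y ?f"
    by (auto simp: normal_mono_def point_isset_def empty_isset_def)
  with ob hom free show ?thesis by blast
qed


section \<open>Deformation retracts are Joyal equivalences\<close>

lemma iso_nerve_sset: "is_sset iso_nerve"
  unfolding is_sset_def iso_nerve_def
  by (auto simp: compose_def fun_eq_iff PiE_iff extensional_def dest: deltaD)

lemma sprod_sset: "is_sset X \<Longrightarrow> is_sset Y \<Longrightarrow> is_sset (sprod X Y)"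
  unfolding is_sset_def sprod_def by auto

lemma htpy_precompose:
  assumes B: "is_sset B" and \<rho>: "\<rho> \<in> smaps B A" and uv: "htpy iso_nerve A K u v"
  shows "htpy iso_nerve B K (scomp B u \<rho>) (scomp B v \<rho>)"
proof -
  have step: "htpy_step iso_nerve B K (scomp B u \<rho>) (scomp B v \<rho>)"
    if uv: "htpy_step iso_nerve A K u v" for u v
  proof -
    obtain H where H: "H \<in> smaps (sprod A iso_nerve) K"
      and ends: "\<And>n s. s \<in> simp A n \<Longrightarrow> H n (s, \<lambda>_\<in>{..n}. 0) = u n s \<and> H n (s, \<lambda>_\<in>{..n}. 1) = v n s"
      and u: "u \<in> smaps A K" and v: "v \<in> smaps A K"
      using uv unfolding htpy_step_def by blast
    define G where "G = (\<lambda>n. \<lambda>st\<in>simp (sprod B iso_nerve) n. H n (\<rho> n (fst st), snd st))"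
    have inA: "(\<rho> n (fst st), snd st) \<in> simp (sprod A iso_nerve) n"
      if "st \<in> simp (sprod B iso_nerve) n" for n st
      using that smap_in[OF \<rho>] by (auto simp: sprod_def)
    have "G \<in> smaps (sprod B iso_nerve) K"
      unfolding G_def
    proof (intro smapsI)
      fix n st assume "st \<in> simp (sprod B iso_nerve) n"
      then show "H n (\<rho> n (fst st), snd st) \<in> simp K n" by (intro smap_in[OF H] inA)
    next
      fix m n \<alpha> st assume \<alpha>: "\<alpha> \<in> delta m n" and st: "st \<in> simp (sprod B iso_nerve) n"
      then show "act (sprod B iso_nerve) m n \<alpha> st \<in> simp (sprod B iso_nerve) m"
        by (intro sset_act sprod_sset B iso_nerve_sset)
      show "H m (\<rho> m (fst (act (sprod B iso_nerve) m n \<alpha> st)), snd (act (sprod B iso_nerve) m n \<alpha> st)) =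
          act K m n \<alpha> (H n (\<rho> n (fst st), snd st))"
        using smap_act[OF H \<alpha> inA[OF st]] smap_act[OF \<rho> \<alpha>] st by (auto simp: sprod_def)
    qed
    moreover have "G n (s, \<lambda>_\<in>{..n}. e) = H n (\<rho> n s, \<lambda>_\<in>{..n}. e)"
      if "s \<in> simp B n" "e = 0 \<or> e = 1" for n s e
      using that by (auto simp: G_def sprod_def iso_nerve_def)
    ultimately show ?thesis
      using ends smap_in[OF \<rho>] scomp_in_smaps[OF B \<rho> u] scomp_in_smaps[OF B \<rho> v]
      unfolding htpy_step_def
      by (intro conjI bexI[of _ G]) (simp_all add: scomp_apply)
  qed
  from uv show ?thesis
  proof (induction rule: equivclp_induct)
    case (step y z)
    then show ?case using \<open>\<And>u v. htpy_step iso_nerve A K u v \<Longrightarrow> _ u v\<close>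
      by (meson equivclp_into_equivclp)
  qed simp
qed

text \<open>Precomposition respects homotopy, so precomposing with \<open>\<rho>\<close> inverts precomposing with \<open>f\<close> on
  homotopy classes of maps into any simplicial set.\<close>

lemma deformation_retract_joyal_equiv:
  assumes A: "is_sset A" and B: "is_sset B"
    and f: "f \<in> smaps A B" and \<rho>: "\<rho> \<in> smaps B A"
    and retract: "\<And>n s. s \<in> simp A n \<Longrightarrow> \<rho> n (f n s) = s"
    and H: "H \<in> smaps (sprod B iso_nerve) B"
    and H0: "\<And>n s. s \<in> simp B n \<Longrightarrow> H n (s, \<lambda>_\<in>{..n}. 0) = f n (\<rho> n s)"
    and H1: "\<And>n s. s \<in> simp B n \<Longrightarrow> H n (s, \<lambda>_\<in>{..n}. 1) = s"
  shows "joyal_equiv A B f"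
  unfolding joyal_equiv_def htpy_class_bij_def
proof (intro allI impI conjI ballI)
  fix K :: "'a sset"
  have deform: "htpy iso_nerve B K (scomp B (scomp A g f) \<rho>) g" if g: "g \<in> smaps B K" for g
  proof (rule r_into_equivclp)
    have G: "scomp (sprod B iso_nerve) g H \<in> smaps (sprod B iso_nerve) K"
      by (intro scomp_in_smaps[OF _ H g] sprod_sset B iso_nerve_sset)
    have ends: "(s, \<lambda>_\<in>{..n}. e) \<in> simp (sprod B iso_nerve) n"
      if "s \<in> simp B n" "e = 0 \<or> e = 1" for n s e
      using that by (auto simp: sprod_def iso_nerve_def)
    show "htpy_step iso_nerve B K (scomp B (scomp A g f) \<rho>) g"
      unfolding htpy_step_def
      using G H0 H1 ends smap_in[OF \<rho>] scomp_in_smaps[OF B \<rho> scomp_in_smaps[OF A f g]] g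
      by (intro conjI bexI[of _ "scomp (sprod B iso_nerve) g H"]) (simp_all add: scomp_apply)
  qed
  {
    fix g h assume g: "g \<in> smaps B K" and h: "h \<in> smaps B K"
      and gh: "htpy iso_nerve A K (scomp A g f) (scomp A h f)"
    have "htpy iso_nerve B K g (scomp B (scomp A g f) \<rho>)" by (rule equivclp_sym[OF deform[OF g]])
    also have "htpy iso_nerve B K (scomp B (scomp A g f) \<rho>) (scomp B (scomp A h f) \<rho>)"
      by (rule htpy_precompose[OF B \<rho> gh])
    also have "htpy iso_nerve B K (scomp B (scomp A h f) \<rho>) h" by (rule deform[OF h])
    finally show "htpy iso_nerve B K g h" .
  }
  {
    fix k assume k: "k \<in> smaps A K"
    have k\<rho>: "scomp B k \<rho> \<in> smaps B K" by (rule scomp_in_smaps[OF B \<rho> k])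
    have "scomp A (scomp B k \<rho>) f = k"
      by (rule smap_ext[OF scomp_in_smaps[OF A f k\<rho>] k])
        (simp add: scomp_apply smap_in[OF f] retract)
    then show "\<exists>g\<in>smaps B K. htpy iso_nerve A K (scomp A g f) k"
      using k\<rho> by (intro bexI[of _ "scomp B k \<rho>"]) simp_all
  }
qed


section \<open>Detecting components by maps to discrete simplicial sets\<close>

text \<open>All faces present in a horn of a discrete simplicial set are equal: any two of them share a
  face as soon as they have positive dimension, and a horn of dimension 1 has only one. The index
  \<open>i0\<close> picks one that is present.\<close>

lemma kan_discrete: "kan_complex (discrete S)"
  unfolding kan_complex_def
proof (intro conjI allI impI)
  show "is_sset (discrete S)" by (simp add: is_sset_def discrete_def)
  fix n k x assume h: "k \<le> Suc n \<and> horn (discrete S) n k x"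
  define i0 where "i0 = (if k = 0 then 1 else 0::nat)"
  have i0: "i0 \<le> Suc n" "i0 \<noteq> k" by (auto simp: i0_def)
  have "x i0 = x i" if i: "i \<le> Suc n" "i \<noteq> k" for i
  proof (cases n)
    case 0
    then show ?thesis using i h by (auto simp: i0_def le_Suc_eq)
  next
    case (Suc m)
    then have "x j = x i" if "i < j" "j \<le> Suc n" "i \<noteq> k" "j \<noteq> k" for i j
      using h that by (auto simp: horn_def face_def discrete_def)
    from this[of i i0] this[of i0 i] show ?thesis using i i0 by (cases i i0 rule: linorder_cases) auto
  qed
  moreover have "x i0 \<in> S" using h i0 by (auto simp: horn_def discrete_def)
  ultimately show "\<exists>z\<in>simp (discrete S) (Suc n). \<forall>i\<le>Suc n. i \<noteq> k \<longrightarrow> face (discrete S) n i z = x i"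
    by (intro bexI[of _ "x i0"]) (auto simp: face_def discrete_def)
qed

text \<open>A homotopy moves a vertex along an edge, and edges of a discrete simplicial set are constant.\<close>

lemma htpy_discrete_vertex:
  assumes B: "is_sset B" and gh: "htpy simplex1 B (discrete S) g h" and v: "v \<in> simp B 0"
  shows "g 0 v = h 0 v"
proof -
  have step: "g 0 v = h 0 v" if gh: "htpy_step simplex1 B (discrete S) g h" for g h
  proof -
    obtain H where H: "H \<in> smaps (sprod B simplex1) (discrete S)"
      and ends: "H 0 (v, \<lambda>_\<in>{..0}. 0) = g 0 v" "H 0 (v, \<lambda>_\<in>{..0}. 1) = h 0 v"
      using gh v unfolding htpy_step_def by blast
    \<comment> \<open>the degenerate edge at \<open>v\<close> paired with the nondegenerate edge of the interval\<close>
    let ?e = "(degen B 1 v, \<lambda>i\<in>{..1::nat}. i)"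
    have e: "?e \<in> simp (sprod B simplex1) 1"
      using degen_in[OF B v, of 1] delta_id[of 1] by (simp add: sprod_def simplex1_def)
    have "H 0 (v, \<lambda>_\<in>{..0}. k) = H 1 ?e" if k: "k \<le> 1" for k
    proof -
      have "act (sprod B simplex1) 0 1 (\<lambda>_\<in>{..0}. k) ?e = (v, \<lambda>_\<in>{..0}. k)"
        using k vertex_degen[OF B k v]
        by (simp add: sprod_def simplex1_def compose_const vertex_def)
      moreover have "H 0 (act (sprod B simplex1) 0 1 (\<lambda>_\<in>{..0}. k) ?e) = H 1 ?e"
        using smap_act[OF H delta_const[OF k] e, of 0] by (simp only: discrete_def sset.simps)
      ultimately show ?thesis by (simp only:)
    qed
    from this[of 0] this[of 1] show ?thesis using ends by simp
  qed
  from gh show ?thesis by (induction rule: equivclp_induct) (auto dest: step)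
qed


section \<open>Mapping spaces of the rigidification\<close>

definition restrict_word :: "nat \<Rightarrow> (nat \<Rightarrow> nat) \<Rightarrow> 'a gen list \<Rightarrow> 'a gen list" where
  "restrict_word l \<beta> = map (\<lambda>(n, \<sigma>, i, j, T). (n, \<sigma>, i, j, compose {..l} T \<beta>))"

lemma chains_compose: "\<beta> \<in> delta l k \<Longrightarrow> T \<in> chains i j k \<Longrightarrow> compose {..l} T \<beta> \<in> chains i j l"
  by (auto simp: chains_def delta_def mono_on_def compose_def Pi_iff PiE_iff)

lemma path_restrict:
  assumes \<beta>: "\<beta> \<in> delta l k"
  shows "path X k x y w \<Longrightarrow> path X l x y (restrict_word l \<beta> w)"
proof (induction rule: path.induct)
  case (Nil x)
  then show ?case by (simp add: restrict_word_def path.Nil)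
next
  case (Cons g x y z w)
  then show ?case
    unfolding restrict_word_def
    by (cases g) (auto intro!: path.Cons simp: gens_def chains_compose[OF \<beta>])
qed

lemma rig_eq_restrict:
  assumes \<beta>: "\<beta> \<in> delta l k"
  shows "rig_eq X k x y w w' \<Longrightarrow> rig_eq X l x y (restrict_word l \<beta> w) (restrict_word l \<beta> w')"
proof (induction rule: rig_eq.induct)
  case (refl x y w)
  then show ?case by (intro rig_eq.refl path_restrict[OF \<beta>])
next
  case (sym x y w w')
  then show ?case by (blast intro: rig_eq.sym)
next
  case (trans x y w w' w'')
  then show ?case by (blast intro: rig_eq.trans)
next
  case (cong x y u u' z v v')
  then show ?case by (auto simp: restrict_word_def intro: rig_eq.cong)
next
  case (ident \<sigma> n i)
  have "compose {..l} (\<lambda>r\<in>{..k}. {i}) \<beta> = (\<lambda>r\<in>{..l}. {i})"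
    using \<beta> by (auto simp: compose_def fun_eq_iff dest: deltaD)
  then show ?case using rig_eq.ident[OF ident, of l] by (simp add: restrict_word_def)
next
  case (comp \<sigma> n i j l' S T)
  have "compose {..l} (\<lambda>r\<in>{..k}. S r \<union> T r) \<beta> =
      (\<lambda>r\<in>{..l}. compose {..l} S \<beta> r \<union> compose {..l} T \<beta> r)"
    using \<beta> by (auto simp: compose_def fun_eq_iff dest: deltaD)
  then show ?case
    using rig_eq.comp[OF comp(1-4) chains_compose[OF \<beta> comp(5)] chains_compose[OF \<beta> comp(6)]]
    by (simp add: restrict_word_def)
next
  case (nat \<sigma> n \<alpha> m i j T)
  have "compose {..l} (\<lambda>r\<in>{..k}. \<alpha> ` T r) \<beta> = (\<lambda>r\<in>{..l}. \<alpha> ` compose {..l} T \<beta> r)"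
    using \<beta> by (auto simp: compose_def fun_eq_iff dest: deltaD)
  then show ?case
    using rig_eq.nat[OF nat(1-4) chains_compose[OF \<beta> nat(5)]]
    by (simp add: restrict_word_def)
qed

lemma rig_class_eq: "rig_eq X k x y w w' \<Longrightarrow> rig_class X k x y w' = rig_class X k x y w"
  unfolding rig_class_def by (blast intro: rig_eq.sym rig_eq.trans)

lemma rig_class_self: "path X k x y w \<Longrightarrow> w \<in> rig_class X k x y w"
  by (simp add: rig_class_def rig_eq.refl)

text \<open>Restriction of words respects the relations, so operators may be computed on representatives.\<close>

lemma rig_space_act:
  assumes \<beta>: "\<beta> \<in> delta l k" and w: "path X k x y w"
  shows "act (rig_space X x y) l k \<beta> (rig_class X k x y w) = rig_class X l x y (restrict_word l \<beta> w)"
proof -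
  have "act (rig_space X x y) l k \<beta> (rig_class X k x y w) =
      (\<Union>w'\<in>rig_class X k x y w. rig_class X l x y (restrict_word l \<beta> w'))"
    by (simp add: rig_space_def restrict_word_def)
  also have "\<dots> = (\<Union>w'\<in>rig_class X k x y w. rig_class X l x y (restrict_word l \<beta> w))"
  proof (rule SUP_cong)
    show "rig_class X k x y w = rig_class X k x y w" by (rule HOL.refl)
    fix w' assume "w' \<in> rig_class X k x y w"
    then have "rig_eq X k x y w w'" unfolding rig_class_def by (rule CollectD)
    then show "rig_class X l x y (restrict_word l \<beta> w') = rig_class X l x y (restrict_word l \<beta> w)"
      by (rule rig_class_eq[OF rig_eq_restrict[OF \<beta>]])
  qed
  also have "\<dots> = rig_class X l x y (restrict_word l \<beta> w)"
    using rig_class_self[OF w] by blast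
  finally show ?thesis .
qed

lemma rig_space_simp: "simp (rig_space X x y) k = {rig_class X k x y w |w. path X k x y w}"
  by (simp add: rig_space_def)

lemma restrict_word_id: "path X k x y w \<Longrightarrow> restrict_word k (\<lambda>i\<in>{..k}. i) w = w"
proof (induction rule: path.induct)
  case (Cons g x y z w)
  have "compose {..k} T (\<lambda>i\<in>{..k}. i) = T" if "T \<in> chains i j k" for T i j
    using that by (auto simp: chains_def compose_def fun_eq_iff PiE_iff extensional_def)
  moreover obtain n \<sigma> i j T where g: "g = (n, \<sigma>, i, j, T)" by (cases g)
  ultimately have T: "compose {..k} T (\<lambda>i\<in>{..k}. i) = T" using Cons by (auto simp: gens_def)
  then show ?case using Cons.IH
    by (simp only: restrict_word_def g list.map split_conv)
qed (simp add: restrict_word_def)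

lemma restrict_word_compose:
  assumes "\<gamma> \<in> delta l m"
  shows "restrict_word l \<gamma> (restrict_word m \<beta> w) = restrict_word l (compose {..l} \<beta> \<gamma>) w"
  using assms by (auto simp: restrict_word_def compose_def fun_eq_iff dest: deltaD)

lemma rig_space_sset: "is_sset (rig_space X x y)"
  unfolding is_sset_def
proof (intro conjI allI ballI)
  fix m n \<alpha> s assume \<alpha>: "\<alpha> \<in> delta m n" and "s \<in> simp (rig_space X x y) n"
  then show "act (rig_space X x y) m n \<alpha> s \<in> simp (rig_space X x y) m"
    by (auto simp: rig_space_simp rig_space_act[OF \<alpha>] intro: path_restrict[OF \<alpha>])
next
  fix n s assume "s \<in> simp (rig_space X x y) n"
  then show "act (rig_space X x y) n n (\<lambda>i\<in>{..n}. i) s = s"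
    by (auto simp: rig_space_simp rig_space_act[OF delta_id] restrict_word_id)
next
  fix l m n \<beta> \<alpha> s
  assume \<beta>: "\<beta> \<in> delta l m" and \<alpha>: "\<alpha> \<in> delta m n" and "s \<in> simp (rig_space X x y) n"
  then show "act (rig_space X x y) l n (compose {..l} \<alpha> \<beta>) s =
      act (rig_space X x y) l m \<beta> (act (rig_space X x y) m n \<alpha> s)"
    by (auto simp: rig_space_simp rig_space_act[OF \<alpha>] rig_space_act[OF \<beta>] path_restrict[OF \<alpha>]
        rig_space_act[OF delta_compose[OF \<beta> \<alpha>]] restrict_word_compose[OF \<beta>])
qed


section \<open>Cocycles and holonomy\<close>

text \<open>An integral 1-cocycle, with \<open>c n \<sigma> i j\<close> its value on the edge of \<open>\<sigma>\<close> from \<open>i\<close> to \<open>j\<close>.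
  It amounts to a functor from the rigidification to the group of integers.\<close>

definition cocycle :: "'a sset \<Rightarrow> (nat \<Rightarrow> 'a \<Rightarrow> nat \<Rightarrow> nat \<Rightarrow> int) \<Rightarrow> bool" where
  "cocycle X c \<longleftrightarrow>
     (\<forall>n. \<forall>\<sigma>\<in>simp X n. \<forall>i j l. i \<le> j \<and> j \<le> l \<and> l \<le> n \<longrightarrow> c n \<sigma> i j + c n \<sigma> j l = c n \<sigma> i l) \<and>
     (\<forall>m n. \<forall>\<alpha>\<in>delta m n. \<forall>\<sigma>\<in>simp X n. \<forall>i j. i \<le> j \<and> j \<le> m \<longrightarrow>
        c m (act X m n \<alpha> \<sigma>) i j = c n \<sigma> (\<alpha> i) (\<alpha> j))"

lemma cocycle_add:
  "cocycle X c \<Longrightarrow> \<sigma> \<in> simp X n \<Longrightarrow> i \<le> j \<Longrightarrow> j \<le> l \<Longrightarrow> l \<le> n \<Longrightarrow>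
    c n \<sigma> i j + c n \<sigma> j l = c n \<sigma> i l"
  unfolding cocycle_def by blast

lemma cocycle_refl: "cocycle X c \<Longrightarrow> \<sigma> \<in> simp X n \<Longrightarrow> i \<le> n \<Longrightarrow> c n \<sigma> i i = 0"
  using cocycle_add[of X c \<sigma> n i i i] by simp

lemma cocycle_act:
  "cocycle X c \<Longrightarrow> \<alpha> \<in> delta m n \<Longrightarrow> \<sigma> \<in> simp X n \<Longrightarrow> i \<le> j \<Longrightarrow> j \<le> m \<Longrightarrow>
    c m (act X m n \<alpha> \<sigma>) i j = c n \<sigma> (\<alpha> i) (\<alpha> j)"
  unfolding cocycle_def by blast

lemma cocycle_degen:
  "cocycle X c \<Longrightarrow> v \<in> simp X 0 \<Longrightarrow> i \<le> j \<Longrightarrow> j \<le> n \<Longrightarrow> c n (degen X n v) i j = 0"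
  by (simp add: cocycle_act delta_const cocycle_refl)

definition holonomy :: "(nat \<Rightarrow> 'a \<Rightarrow> nat \<Rightarrow> nat \<Rightarrow> int) \<Rightarrow> 'a gen list \<Rightarrow> int" where
  "holonomy c w = (\<Sum>(n, \<sigma>, i, j, T)\<leftarrow>w. c n \<sigma> i j)"

lemma holonomy_restrict: "holonomy c (restrict_word l \<beta> w) = holonomy c w"
  by (induction w) (auto simp: holonomy_def restrict_word_def)

lemma holonomy_rig_eq:
  assumes c: "cocycle X c"
  shows "rig_eq X k x y w w' \<Longrightarrow> holonomy c w = holonomy c w'"
  by (induction rule: rig_eq.induct)
    (auto simp: holonomy_def cocycle_refl[OF c] cocycle_add[OF c] cocycle_act[OF c])

text \<open>Whether the holonomy vanishes is constant on components of the mapping spaces.\<close>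

definition holonomy_map ::
  "'a sset \<Rightarrow> (nat \<Rightarrow> 'a \<Rightarrow> nat \<Rightarrow> nat \<Rightarrow> int) \<Rightarrow> 'b \<Rightarrow> 'b \<Rightarrow> 'a \<Rightarrow> 'a \<Rightarrow>
   nat \<Rightarrow> 'a gen list set \<Rightarrow> 'b" where
  "holonomy_map X c p q x y k =
     (\<lambda>C\<in>simp (rig_space X x y) k. if \<exists>w\<in>C. holonomy c w = 0 then p else q)"

lemma holonomy_map_class:
  assumes c: "cocycle X c" and w: "path X k x y w"
  shows "holonomy_map X c p q x y k (rig_class X k x y w) = (if holonomy c w = 0 then p else q)"
proof -
  have "(\<exists>w'\<in>rig_class X k x y w. holonomy c w' = 0) \<longleftrightarrow> holonomy c w = 0"
  proof
    assume "\<exists>w'\<in>rig_class X k x y w. holonomy c w' = 0"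
    then obtain w' where "rig_eq X k x y w w'" and "holonomy c w' = 0"
      unfolding rig_class_def by blast
    then show "holonomy c w = 0" by (simp only: holonomy_rig_eq[OF c])
  qed (use rig_class_self[OF w] in blast)
  moreover have "rig_class X k x y w \<in> simp (rig_space X x y) k"
    using w unfolding rig_space_simp by blast
  ultimately show ?thesis by (simp add: holonomy_map_def)
qed

lemma holonomy_map_smap:
  assumes c: "cocycle X c"
  shows "holonomy_map X c p q x y \<in> smaps (rig_space X x y) (discrete {p, q})"
  unfolding holonomy_map_def
proof (intro smapsI)
  fix m n \<alpha> s assume \<alpha>: "\<alpha> \<in> delta m n" and s: "s \<in> simp (rig_space X x y) n"
  then show act: "act (rig_space X x y) m n \<alpha> s \<in> simp (rig_space X x y) m"
    by (rule sset_act[OF rig_space_sset])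
  obtain w where w: "path X n x y w" and s_eq: "s = rig_class X n x y w"
    using s by (auto simp: rig_space_simp)
  have "holonomy_map X c p q x y m (act (rig_space X x y) m n \<alpha> s) = holonomy_map X c p q x y n s"
    by (simp add: s_eq rig_space_act[OF \<alpha> w] holonomy_map_class[OF c] w path_restrict[OF \<alpha> w]
        holonomy_restrict)
  then show "(if \<exists>w\<in>act (rig_space X x y) m n \<alpha> s. holonomy c w = 0 then p else q) =
      act (discrete {p, q}) m n \<alpha> (if \<exists>w\<in>s. holonomy c w = 0 then p else q)"
    using act s by (simp add: holonomy_map_def discrete_def)
qed (simp add: discrete_def)

lemma cocycle_pullback:
  assumes f: "f \<in> smaps X Y" and c: "cocycle Y c"
  shows "cocycle X (\<lambda>n \<sigma>. c n (f n \<sigma>))"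
  unfolding cocycle_def using c by (auto simp: smap_in[OF f] smap_act[OF f] cocycle_add cocycle_act)

lemma holonomy_path_zero:
  assumes "\<And>n \<sigma> i j. \<sigma> \<in> simp X n \<Longrightarrow> i \<le> j \<Longrightarrow> j \<le> n \<Longrightarrow> c n \<sigma> i j = 0"
  shows "path X k x y w \<Longrightarrow> holonomy c w = 0"
  by (induction rule: path.induct) (auto simp: holonomy_def gens_def assms)

text \<open>If a cocycle vanishes on the image of \<open>f\<close>, then the mapping spaces of the source reach only
  components of holonomy zero, and a path of nonzero holonomy lies in none of them. The test
  object that separates the two is a discrete set with two elements.\<close>

lemma cocycle_detects_non_equiv:
  fixes X Y :: "'a sset"
  assumes f: "f \<in> smaps X Y" and c: "cocycle Y c"
    and zero: "\<And>n \<sigma> i j. \<sigma> \<in> simp X n \<Longrightarrow> i \<le> j \<Longrightarrow> j \<le> n \<Longrightarrow> c n (f n \<sigma>) i j = 0"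
    and loop: "path Y 0 (f 0 x) (f 0 y) loop" and nonzero: "holonomy c loop \<noteq> 0"
  shows "\<not> weak_htpy_equiv (rig_space X x y) (rig_space Y (f 0 x) (f 0 y)) (rig_map X Y f x y)"
proof
  assume weq: "weak_htpy_equiv (rig_space X x y) (rig_space Y (f 0 x) (f 0 y)) (rig_map X Y f x y)"
  let ?A = "rig_space X x y" and ?B = "rig_space Y (f 0 x) (f 0 y)"
  \<comment> \<open>any two distinct elements of the universe of the mapping spaces serve as components\<close>
  define p q :: "'a gen list set" where "p = {}" and "q = {[]}"
  let ?K = "discrete {p, q}"
  let ?g = "holonomy_map Y c p q (f 0 x) (f 0 y)"
  let ?h = "holonomy_map Y (\<lambda>_ _ _ _. 0) p q (f 0 x) (f 0 y)"
  \<comment> \<open>the zero cocycle gives the constant map to \<open>p\<close>, which agrees with \<open>?g\<close> on the source\<close>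
  have c0: "cocycle Y (\<lambda>_ _ _ _. 0)" by (simp add: cocycle_def)
  have agree: "?g k (rig_map X Y f x y k C) = ?h k (rig_map X Y f x y k C)"
    if C: "C \<in> simp ?A k" for k C
  proof (cases "rig_map X Y f x y k C \<in> simp ?B k")
    case False
    then show ?thesis by (simp add: holonomy_map_def)
  next
    case True
    let ?fw = "map (\<lambda>(n, \<sigma>, i, j, T). (n, f n \<sigma>, i, j, T))"
    obtain w0 where w0: "path X k x y w0" and C_eq: "C = rig_class X k x y w0"
      using C by (auto simp: rig_space_simp)
    obtain w1 where w1: "path Y k (f 0 x) (f 0 y) w1"
      and D_eq: "rig_map X Y f x y k C = rig_class Y k (f 0 x) (f 0 y) w1"
      using True by (auto simp: rig_space_simp)
    have "w1 \<in> (\<Union>w\<in>C. rig_class Y k (f 0 x) (f 0 y) (?fw w))"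
      using rig_class_self[OF w1] C by (simp add: D_eq[symmetric] rig_map_def)
    then obtain w where w: "w \<in> C" and "rig_eq Y k (f 0 x) (f 0 y) (?fw w) w1"
      by (auto simp: rig_class_def)
    then have "holonomy c w1 = holonomy c (?fw w)" by (simp only: holonomy_rig_eq[OF c])
    also have "\<dots> = holonomy (\<lambda>n \<sigma>. c n (f n \<sigma>)) w"
      by (induction w) (auto simp: holonomy_def)
    also have "\<dots> = holonomy (\<lambda>n \<sigma>. c n (f n \<sigma>)) w0"
      by (rule holonomy_rig_eq[OF cocycle_pullback[OF f c], symmetric])
        (use w in \<open>simp add: C_eq rig_class_def\<close>)
    also have "\<dots> = 0" by (rule holonomy_path_zero[OF zero w0])
    finally have "holonomy c w1 = 0" .
    moreover have "holonomy (\<lambda>_ _ _ _. 0) w1 = 0" by (induction w1) (auto simp: holonomy_def)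
    ultimately show ?thesis
      by (simp add: D_eq holonomy_map_class[OF c w1] holonomy_map_class[OF c0 w1])
  qed
  have "scomp ?A ?g (rig_map X Y f x y) = scomp ?A ?h (rig_map X Y f x y)"
    using agree by (auto simp: scomp_def compose_def fun_eq_iff)
  then have "htpy simplex1 ?A ?K (scomp ?A ?g (rig_map X Y f x y)) (scomp ?A ?h (rig_map X Y f x y))"
    by simp
  moreover have "htpy_class_bij simplex1 ?A ?B (rig_map X Y f x y) ?K"
    using weq kan_discrete unfolding weak_htpy_equiv_def by blast
  moreover have "?g \<in> smaps ?B ?K" "?h \<in> smaps ?B ?K"
    by (rule holonomy_map_smap[OF c], rule holonomy_map_smap[OF c0])
  ultimately have "htpy simplex1 ?B ?K ?g ?h"
    unfolding htpy_class_bij_def by simp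
  moreover have "rig_class Y 0 (f 0 x) (f 0 y) loop \<in> simp ?B 0"
    using loop by (auto simp: rig_space_simp)
  ultimately have "?g 0 (rig_class Y 0 (f 0 x) (f 0 y) loop) = ?h 0 (rig_class Y 0 (f 0 x) (f 0 y) loop)"
    by (rule htpy_discrete_vertex[OF rig_space_sset])
  moreover have "holonomy (\<lambda>_ _ _ _. 0) loop = 0" by (induction loop) (auto simp: holonomy_def)
  ultimately show False
    using nonzero by (simp add: holonomy_map_class[OF c loop] holonomy_map_class[OF c0 loop] p_def q_def)
qed

text \<open>Identified simplices are totally degenerate, and there every cocycle vanishes.\<close>

lemma cocycle_tag_rep:
  assumes X: "is_AInv X" and c: "cocycle (und X) c"
    and s: "s \<in> simp (und X) n" and ij: "i \<le> j" "j \<le> n"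
  shows "c n (tag_rep X n s) i j = c n s i j"
  using tag_eq_rep[OF X s] ij by (auto simp: tag_eq_def cocycle_degen[OF c] inv_in[OF X])

lemma cocycle_shriek:
  assumes X: "is_AInv X" and c: "cocycle (und X) c"
  shows "cocycle (und (qtag_shriek_ob X)) c"
  unfolding cocycle_def
  using c X by (auto simp: cocycle_add tag_rep_in cocycle_tag_rep sset_act AInv_sset cocycle_act)


section \<open>Two free copies of a point and of the walking isomorphism\<close>

text \<open>A set \<open>S \<subseteq> {..n}\<close> stands for the \<open>n\<close>-simplex of \<open>iso_nerve\<close> that is 1 exactly on \<open>S\<close>, and the
  boolean selects one of two copies, which the involution exchanges. The parameter \<open>P\<close> cuts out
  a simplicial subset, and \<open>e\<close> places the countably many codes into the given universe.\<close>

definition decode :: "(nat set \<times> bool \<Rightarrow> 'a) \<Rightarrow> 'a \<Rightarrow> nat set \<times> bool" where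
  "decode e = inv_into ({S. finite S} \<times> UNIV) e"

definition twin_sset :: "(nat set \<times> bool \<Rightarrow> 'a) \<Rightarrow> (nat \<Rightarrow> nat set set) \<Rightarrow> 'a sset" where
  "twin_sset e P = \<lparr>simp = (\<lambda>n. e ` (P n \<times> UNIV)),
     act = (\<lambda>m n \<alpha> s. e ({i. i \<le> m \<and> \<alpha> i \<in> fst (decode e s)}, snd (decode e s)))\<rparr>"

definition twin :: "(nat set \<times> bool \<Rightarrow> 'a) \<Rightarrow> (nat \<Rightarrow> nat set set) \<Rightarrow> 'a isset" where
  "twin e P = \<lparr>und = twin_sset e P,
     inv_of = (\<lambda>n. \<lambda>s\<in>simp (twin_sset e P) n.
       e ({i. i \<le> n \<and> n - i \<in> fst (decode e s)}, \<not> snd (decode e s)))\<rparr>"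

definition twin_points :: "(nat set \<times> bool \<Rightarrow> 'a) \<Rightarrow> 'a isset" where
  "twin_points e = twin e (\<lambda>_. {{}})"

definition twin_isos :: "(nat set \<times> bool \<Rightarrow> 'a) \<Rightarrow> 'a isset" where
  "twin_isos e = twin e (\<lambda>n. Pow {..n})"

definition twin_inclusion :: "(nat set \<times> bool \<Rightarrow> 'a) \<Rightarrow> nat \<Rightarrow> 'a \<Rightarrow> 'a" where
  "twin_inclusion e = (\<lambda>n. \<lambda>s\<in>simp (und (twin_points e)) n. s)"

context
  fixes e :: "nat set \<times> bool \<Rightarrow> 'a"
  assumes inj: "inj_on e ({S. finite S} \<times> UNIV)"
begin

lemma decode: "finite S \<Longrightarrow> decode e (e (S, b)) = (S, b)"
  unfolding decode_def by (rule inv_into_f_f[OF inj]) simp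

lemma twin_AInv:
  assumes sub: "\<And>n S. S \<in> P n \<Longrightarrow> S \<subseteq> {..n}"
    and P_act: "\<And>m n \<alpha> S. \<alpha> \<in> delta m n \<Longrightarrow> S \<in> P n \<Longrightarrow> {i. i \<le> m \<and> \<alpha> i \<in> S} \<in> P m"
    and P_rev: "\<And>n S. S \<in> P n \<Longrightarrow> {i. i \<le> n \<and> n - i \<in> S} \<in> P n"
  shows "is_AInv (twin e P)"
proof -
  have fin: "finite S" if "S \<in> P n" for S n
    using sub[OF that] by (rule finite_subset) simp
  have dec: "decode e (e (S, b)) = (S, b)" if "S \<in> P n" for S n b
    using decode[OF fin[OF that]] .
  have sset: "is_sset (twin_sset e P)"
    unfolding is_sset_def
  proof (intro conjI allI ballI)
    fix m n \<alpha> s assume "\<alpha> \<in> delta m n" "s \<in> simp (twin_sset e P) n"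
    then show "act (twin_sset e P) m n \<alpha> s \<in> simp (twin_sset e P) m"
      by (auto simp: twin_sset_def dec P_act)
  next
    fix n s assume "s \<in> simp (twin_sset e P) n"
    then obtain S b where s: "s = e (S, b)" "S \<in> P n" by (auto simp: twin_sset_def)
    have "{i. i \<le> n \<and> (\<lambda>i\<in>{..n}. i) i \<in> S} = S" using sub[OF s(2)] by auto
    then show "act (twin_sset e P) n n (\<lambda>i\<in>{..n}. i) s = s"
      by (simp only: twin_sset_def sset.simps s(1) dec[OF s(2)] fst_conv snd_conv)
  next
    fix l m n \<beta> \<alpha> s
    assume \<beta>: "\<beta> \<in> delta l m" and \<alpha>: "\<alpha> \<in> delta m n" and "s \<in> simp (twin_sset e P) n"
    then obtain S b where s: "s = e (S, b)" "S \<in> P n" by (auto simp: twin_sset_def)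
    have "{i. i \<le> l \<and> compose {..l} \<alpha> \<beta> i \<in> S} = {i. i \<le> l \<and> \<beta> i \<in> {i. i \<le> m \<and> \<alpha> i \<in> S}}"
      using \<beta> by (auto simp: compose_def dest: deltaD)
    then show "act (twin_sset e P) l n (compose {..l} \<alpha> \<beta>) s =
        act (twin_sset e P) l m \<beta> (act (twin_sset e P) m n \<alpha> s)"
      by (simp only: twin_sset_def sset.simps s(1) dec[OF s(2)] dec[OF P_act[OF \<alpha> s(2)]]
          fst_conv snd_conv)
  qed
  show ?thesis
    unfolding twin_def
  proof (intro is_AInvI sset)
    fix n s assume "s \<in> simp (twin_sset e P) n"
    then obtain S b where s: "s = e (S, b)" "S \<in> P n" by (auto simp: twin_sset_def)
    let ?t = "\<lambda>n s. e ({i. i \<le> n \<and> n - i \<in> fst (decode e s)}, \<not> snd (decode e s))"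
    show "?t n s \<in> simp (twin_sset e P) n"
      using s by (simp add: twin_sset_def dec P_rev)
    have "{i. i \<le> n \<and> n - i \<in> {i. i \<le> n \<and> n - i \<in> S}} = S" using sub[OF s(2)] by auto
    then show "?t n (?t n s) = s"
      by (simp only: s(1) dec[OF s(2)] dec[OF P_rev[OF s(2)]] fst_conv snd_conv not_not)
  next
    fix m n \<alpha> s assume \<alpha>: "\<alpha> \<in> delta m n" and "s \<in> simp (twin_sset e P) n"
    then obtain S b where s: "s = e (S, b)" "S \<in> P n" by (auto simp: twin_sset_def)
    have "{i. i \<le> m \<and> m - i \<in> {i. i \<le> m \<and> \<alpha> i \<in> S}} =
        {i. i \<le> m \<and> (\<lambda>i\<in>{..m}. n - \<alpha> (m - i)) i \<in> {i. i \<le> n \<and> n - i \<in> S}}"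
      using deltaD[OF \<alpha>] by auto
    then show "e ({i. i \<le> m \<and> m - i \<in> fst (decode e (act (twin_sset e P) m n \<alpha> s))},
          \<not> snd (decode e (act (twin_sset e P) m n \<alpha> s))) =
        act (twin_sset e P) m n (\<lambda>i\<in>{..m}. n - \<alpha> (m - i))
          (e ({i. i \<le> n \<and> n - i \<in> fst (decode e s)}, \<not> snd (decode e s)))"
      by (simp only: twin_sset_def sset.simps s(1) dec[OF s(2)] dec[OF P_act[OF \<alpha> s(2)]]
          dec[OF P_rev[OF s(2)]] fst_conv snd_conv)
  qed
qed

lemma twin_points_AInv: "is_AInv (twin_points e)"
  unfolding twin_points_def by (rule twin_AInv) auto

lemma twin_isos_AInv: "is_AInv (twin_isos e)"
  unfolding twin_isos_def by (rule twin_AInv) auto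

lemma twin_simps:
  "simp (und (twin_points e)) n = e ` ({{}} \<times> UNIV)"
  "simp (und (twin_isos e)) n = e ` (Pow {..n} \<times> UNIV)"
  "finite S \<Longrightarrow> act (und (twin_points e)) m n \<alpha> (e (S, b)) = e ({i. i \<le> m \<and> \<alpha> i \<in> S}, b)"
  "finite S \<Longrightarrow> act (und (twin_isos e)) m n \<alpha> (e (S, b)) = e ({i. i \<le> m \<and> \<alpha> i \<in> S}, b)"
  "inv_of (twin_points e) n (e ({}, b)) = e ({}, \<not> b)"
  "S \<subseteq> {..n} \<Longrightarrow> inv_of (twin_isos e) n (e (S, b)) = e ({i. i \<le> n \<and> n - i \<in> S}, \<not> b)"
  using decode[of "{}"] decode[OF finite_subset[OF _ finite_atMost]]
  by (auto simp: twin_points_def twin_isos_def twin_def twin_sset_def decode)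

lemma twin_isos_cases:
  assumes "s \<in> simp (und (twin_isos e)) n"
  obtains S b where "s = e (S, b)" "S \<subseteq> {..n}" "finite S"
proof -
  obtain S b where "s = e (S, b)" "S \<subseteq> {..n}" using assms by (auto simp: twin_simps)
  then show ?thesis using that finite_subset[of S "{..n}"] by simp
qed

lemma twin_inclusion_equivariant:
  "twin_inclusion e \<in> equivariant_maps (twin_points e) (twin_isos e)"
proof -
  have "twin_inclusion e \<in> smaps (und (twin_points e)) (und (twin_isos e))"
    unfolding twin_inclusion_def
    by (intro smapsI sset_act[OF AInv_sset[OF twin_points_AInv]]) (auto simp: twin_simps)
  then show ?thesis
    by (auto simp: equivariant_maps_def twin_inclusion_def twin_simps)
qed

text \<open>The involution moves every simplex to the other copy, so it is free on all of \<open>twin_isos\<close>.\<close>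

lemma twin_inclusion_normal: "normal_mono (twin_points e) (twin_isos e) (twin_inclusion e)"
proof -
  have "inv_of (twin_isos e) n s \<noteq> s" if "s \<in> simp (und (twin_isos e)) n" for n s
    using that
  proof (cases rule: twin_isos_cases)
    case (1 S b)
    have "finite {i. i \<le> n \<and> n - i \<in> S}" by simp
    then show ?thesis using 1 by (auto simp: twin_simps dest!: inj_onD[OF inj])
  qed
  then show ?thesis
    by (auto simp: normal_mono_def smono_def twin_inclusion_def nondegenerate_def inj_on_def)
qed

text \<open>Each copy of the walking isomorphism contracts onto its object 0.\<close>

lemma twin_inclusion_joyal_equiv:
  "joyal_equiv (und (twin_points e)) (und (twin_isos e)) (twin_inclusion e)"
proof -
  let ?A = "und (twin_points e)" and ?B = "und (twin_isos e)"
  \<comment> \<open>restricting \<open>S\<close> to the places where the homotopy parameter is 1 interpolates between \<open>{}\<close> and \<open>S\<close>\<close>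
  define \<rho> where "\<rho> = (\<lambda>n. \<lambda>s\<in>simp ?B n. e ({}, snd (decode e s)))"
  define H where "H = (\<lambda>n. \<lambda>st\<in>simp (sprod ?B iso_nerve) n.
    e ({i. i \<in> fst (decode e (fst st)) \<and> snd st i = 1}, snd (decode e (fst st))))"
  have A: "is_sset ?A" and B: "is_sset ?B"
    by (rule AInv_sset[OF twin_points_AInv], rule AInv_sset[OF twin_isos_AInv])
  have \<rho>: "\<rho> \<in> smaps ?B ?A"
    unfolding \<rho>_def
  proof (intro smapsI sset_act[OF B])
    fix n s assume "s \<in> simp ?B n"
    then show "e ({}, snd (decode e s)) \<in> simp ?A n" by (simp add: twin_simps)
    fix m \<alpha> assume "\<alpha> \<in> delta m n"
    from \<open>s \<in> simp ?B n\<close>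
    show "e ({}, snd (decode e (act ?B m n \<alpha> s))) = act ?A m n \<alpha> (e ({}, snd (decode e s)))"
      by (cases rule: twin_isos_cases) (simp add: twin_simps decode)
  qed
  have \<rho>_code: "\<rho> n (e (S, b)) = e ({}, b)" if "S \<subseteq> {..n}" for n S b
    using that finite_subset[of S "{..n}"] by (simp add: \<rho>_def twin_simps decode)
  have H: "H \<in> smaps (sprod ?B iso_nerve) ?B"
    unfolding H_def
  proof (intro smapsI sset_act[OF sprod_sset[OF B iso_nerve_sset]])
    fix n st assume "st \<in> simp (sprod ?B iso_nerve) n"
    then obtain S b t where st: "st = (e (S, b), t)" "S \<subseteq> {..n}" "finite S"
      by (auto simp: sprod_def elim!: twin_isos_cases)
    then show "e ({i. i \<in> fst (decode e (fst st)) \<and> snd st i = 1}, snd (decode e (fst st)))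
        \<in> simp ?B n"
      by (auto simp: decode twin_simps)
    fix m \<alpha> assume \<alpha>: "\<alpha> \<in> delta m n"
    have "{i. i \<in> {i. i \<le> m \<and> \<alpha> i \<in> S} \<and> compose {..m} t \<alpha> i = 1} =
        {i. i \<le> m \<and> \<alpha> i \<in> {i. i \<in> S \<and> t i = 1}}"
      by (auto simp: compose_def)
    moreover have "act (sprod ?B iso_nerve) m n \<alpha> st =
        (e ({i. i \<le> m \<and> \<alpha> i \<in> S}, b), compose {..m} t \<alpha>)"
      using st by (simp add: sprod_def iso_nerve_def twin_simps)
    moreover have "finite {i. i \<le> m \<and> \<alpha> i \<in> S}" "finite {i. i \<in> S \<and> t i = 1}"
      using st(3) by simp_all
    ultimately show "e ({i. i \<in> fst (decode e (fst (act (sprod ?B iso_nerve) m n \<alpha> st))) \<and>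
          snd (act (sprod ?B iso_nerve) m n \<alpha> st) i = 1},
          snd (decode e (fst (act (sprod ?B iso_nerve) m n \<alpha> st)))) =
        act ?B m n \<alpha> (e ({i. i \<in> fst (decode e (fst st)) \<and> snd st i = 1}, snd (decode e (fst st))))"
      using st by (simp only: decode twin_simps fst_conv snd_conv)
  qed auto
  have H_code: "H n (e (S, b), \<lambda>_\<in>{..n}. k) = e ({i. i \<in> S \<and> k = 1}, b)"
    if "S \<subseteq> {..n}" "k = 0 \<or> k = 1" for n S b and k :: nat
  proof -
    have "finite S" using that(1) by (rule finite_subset) simp
    moreover have "{i. i \<in> S \<and> (\<lambda>_\<in>{..n}. k) i = 1} = {i. i \<in> S \<and> k = 1}"
      using that(1) by auto
    moreover have "(e (S, b), \<lambda>_\<in>{..n}. k) \<in> simp (sprod ?B iso_nerve) n"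
      using that by (auto simp: sprod_def iso_nerve_def twin_simps)
    ultimately show ?thesis by (simp only: H_def restrict_apply' decode fst_conv snd_conv)
  qed
  show ?thesis
  proof (rule deformation_retract_joyal_equiv[OF A B equivariant_smap[OF twin_inclusion_equivariant] \<rho> _ H])
    fix n s assume "s \<in> simp ?A n"
    then show "\<rho> n (twin_inclusion e n s) = s"
      by (auto simp: twin_inclusion_def twin_simps \<rho>_code)
  next
    fix n s assume "s \<in> simp ?B n"
    then obtain S b where s: "s = e (S, b)" "S \<subseteq> {..n}" by (rule twin_isos_cases)
    then show "H n (s, \<lambda>_\<in>{..n}. 0) = twin_inclusion e n (\<rho> n s)" "H n (s, \<lambda>_\<in>{..n}. 1) = s"
      by (simp_all add: H_code \<rho>_code twin_inclusion_def twin_simps)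
  qed
qed

text \<open>The coboundary of the vertex coordinate on the copy labelled \<open>True\<close>, and zero on the other
  copy. Each restriction is a coboundary, but in the quotient the two copies share their
  vertices, and no function on vertices has the two coboundaries at once.\<close>

definition twin_cocycle :: "nat \<Rightarrow> 'a \<Rightarrow> nat \<Rightarrow> nat \<Rightarrow> int" where
  "twin_cocycle n s i j = (if snd (decode e s)
     then of_bool (j \<in> fst (decode e s)) - of_bool (i \<in> fst (decode e s)) else 0)"

lemma twin_cocycle: "cocycle (und (twin_isos e)) twin_cocycle"
proof -
  have "twin_cocycle m (act (und (twin_isos e)) m n \<alpha> s) i j = twin_cocycle n s (\<alpha> i) (\<alpha> j)"
    if "s \<in> simp (und (twin_isos e)) n" "i \<le> j" "j \<le> m" for m n \<alpha> s i j
    using that(1)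
    by (cases rule: twin_isos_cases) (use that(2,3) in \<open>simp add: twin_cocycle_def twin_simps decode\<close>)
  then show ?thesis by (simp add: cocycle_def twin_cocycle_def)
qed

text \<open>In the quotient, the edge from 0 to 1 of one copy and the edge from 1 to 0 of the other compose
  to a loop with holonomy 1, whereas everything coming from the two points has holonomy 0.\<close>

lemma shriek_twin_inclusion_not_equiv:
  "\<exists>x\<in>simp (und (qtag_shriek_ob (twin_points e))) 0.
     \<not> weak_htpy_equiv (rig_space (und (qtag_shriek_ob (twin_points e))) x x)
       (rig_space (und (qtag_shriek_ob (twin_isos e)))
         (snd qtag_shriek (twin_points e) (twin_isos e) (twin_inclusion e) 0 x)
         (snd qtag_shriek (twin_points e) (twin_isos e) (twin_inclusion e) 0 x))
       (rig_map (und (qtag_shriek_ob (twin_points e))) (und (qtag_shriek_ob (twin_isos e)))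
         (snd qtag_shriek (twin_points e) (twin_isos e) (twin_inclusion e)) x x)"
proof -
  let ?A = "twin_points e" and ?B = "twin_isos e"
  let ?f = "snd qtag_shriek ?A ?B (twin_inclusion e)"
  let ?QA = "und (qtag_shriek_ob ?A)" and ?QB = "und (qtag_shriek_ob ?B)"
  note A = twin_points_AInv and B = twin_isos_AInv and i = twin_inclusion_equivariant
  note f = equivariant_smap[OF shriek_hom[OF A B i]]
  note c = cocycle_shriek[OF B twin_cocycle]
  have f_apply: "?f n s = tag_rep ?B n (twin_inclusion e n s)" if "s \<in> simp ?QA n" for n s
    using that by (simp add: qtag_shriek_def)
  have QA: "s \<in> simp (und ?A) n" if "s \<in> simp ?QA n" for n s
    using that tag_rep_in[OF A] by auto
  have vert: "tag_rep ?B 0 (e (S, True)) = tag_rep ?B 0 (e (S, False))" if S: "S \<subseteq> {..0}" for S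
  proof -
    have v: "e (S, True) \<in> simp (und ?B) 0" using S by (simp add: twin_simps)
    have "{i. i \<le> 0 \<and> 0 - i \<in> S} = S" using S by auto
    then have "inv_of ?B 0 (e (S, True)) = e (S, False)" using S by (simp add: twin_simps(6))
    then show ?thesis
      using tag_rep_cong[OF B, of 0 "e (S, True)" "e (S, False)"] v
      by (auto simp: tag_eq_def degen_0 AInv_sset[OF B] inv_in[OF B])
  qed
  define x where "x = tag_rep ?A 0 (e ({}, False))"
  have x_in: "x \<in> simp ?QA 0" by (simp add: x_def twin_simps)
  have fx: "?f 0 x = tag_rep ?B 0 (e ({}, False))"
    using tag_rep_map[OF A B i, of "e ({}, False)" 0] f_apply[OF x_in]
    by (simp add: x_def twin_simps twin_inclusion_def)
  \<comment> \<open>out along the isomorphism of one copy and back along that of the other\<close>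
  define T where "T = (\<lambda>r\<in>{..0::nat}. {0, 1::nat})"
  define outward and return where "outward = tag_rep ?B 1 (e ({1}, True))" and "return = tag_rep ?B 1 (e ({0}, False))"
  define loop where "loop = [(1::nat, outward, 0::nat, 1::nat, T), (1, return, 0, 1, T)]"
  have edge: "e (S, b) \<in> simp (und ?B) 1" if "S \<subseteq> {..1}" for S b
    using that by (simp add: twin_simps)
  have Q_edge: "tag_rep ?B 1 (e (S, b)) \<in> simp ?QB 1" if "S \<subseteq> {..1}" for S b
    using edge[OF that] by simp
  have Q_vertex: "vertex ?QB 1 k (tag_rep ?B 1 (e (S, b))) =
      tag_rep ?B 0 (e ({i. i \<le> 0 \<and> k \<in> S}, False))" if "S \<subseteq> {..1}" "k \<le> 1" for S b k
  proof -
    have fin: "finite S" using that(1) by (rule finite_subset) simp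
    have eq: "{i. i \<le> 0 \<and> (\<lambda>_\<in>{..0}. k) i \<in> S} = {i. i \<le> (0::nat) \<and> k \<in> S}" by auto
    have "vertex ?QB 1 k (tag_rep ?B 1 (e (S, b))) = tag_rep ?B 0 (vertex (und ?B) 1 k (e (S, b)))"
      using tag_rep_act[OF B delta_const[OF that(2), of 0] edge[OF that(1)]]
      by (simp add: vertex_def)
    also have "vertex (und ?B) 1 k (e (S, b)) = e ({i. i \<le> 0 \<and> k \<in> S}, b)"
      unfolding vertex_def by (simp only: twin_simps(4)[OF fin] eq)
    also have "tag_rep ?B 0 \<dots> = tag_rep ?B 0 (e ({i. i \<le> 0 \<and> k \<in> S}, False))"
      by (cases b) (auto intro!: vert)
    finally show ?thesis .
  qed
  have T: "T \<in> Defs.chains 0 1 0"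
    by (auto simp: T_def Defs.chains_def mono_on_def)
  define y where "y = tag_rep ?B 0 (e ({0}, False))"
  have eq0: "{i. i \<le> (0::nat)} = {0}" by auto
  have outward_gen: "(1, outward, 0, 1, T) \<in> gens ?QB 0 (?f 0 x) y"
    using Q_edge[of "{1}" True] T Q_vertex[of "{1}" 0 True] Q_vertex[of "{1}" 1 True]
    unfolding gens_def fx y_def outward_def by (simp add: eq0 del: shriek_simps)
  have return_gen: "(1, return, 0, 1, T) \<in> gens ?QB 0 y (?f 0 x)"
    using Q_edge[of "{0}" False] T Q_vertex[of "{0}" 0 False] Q_vertex[of "{0}" 1 False]
    unfolding gens_def fx y_def return_def by (simp add: eq0 del: shriek_simps)
  have "path ?QB 0 (?f 0 x) (?f 0 x) loop"
    unfolding loop_def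
    by (intro path.Cons[OF outward_gen] path.Cons[OF return_gen] path.Nil smap_in[OF f x_in])
  moreover have "twin_cocycle 1 (tag_rep ?B 1 (e (S, b))) 0 1 =
      (if b then of_bool (1 \<in> S) - of_bool (0 \<in> S) else 0)" if S: "S \<subseteq> {..1}" for S b
    using cocycle_tag_rep[OF B twin_cocycle edge[OF S], of 0 1] decode[OF finite_subset[OF S]]
    by (simp add: twin_cocycle_def)
  then have "twin_cocycle 1 outward 0 1 = 1" "twin_cocycle 1 return 0 1 = 0"
    by (simp_all add: outward_def return_def)
  then have "holonomy twin_cocycle loop \<noteq> 0"
    by (simp add: holonomy_def loop_def)
  moreover have "twin_cocycle n (?f n s) i j = 0"
    if s: "s \<in> simp ?QA n" and ij: "i \<le> j" "j \<le> n" for n s i j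
  proof -
    obtain b where b: "s = e ({}, b)" using QA[OF s] by (auto simp: twin_simps)
    have "twin_inclusion e n s = e ({}, b)" using b by (simp add: twin_inclusion_def twin_simps)
    then have "twin_cocycle n (?f n s) i j = twin_cocycle n (tag_rep ?B n (e ({}, b))) i j"
      by (simp only: f_apply[OF s])
    also have "\<dots> = twin_cocycle n (e ({}, b)) i j"
      by (rule cocycle_tag_rep[OF B twin_cocycle _ ij]) (simp add: twin_simps)
    also have "\<dots> = 0" by (simp add: twin_cocycle_def decode)
    finally show ?thesis .
  qed
  ultimately have "\<not> weak_htpy_equiv (rig_space ?QA x x) (rig_space ?QB (?f 0 x) (?f 0 x))
      (rig_map ?QA ?QB ?f x x)"
    by (intro cocycle_detects_non_equiv[OF f c])
  then show ?thesis using x_in by (rule bexI)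
qed

end

lemma exists_encoding:
  assumes "infinite (UNIV :: 'a set)"
  shows "\<exists>e :: nat set \<times> bool \<Rightarrow> 'a. inj_on e ({S. finite S} \<times> UNIV)"
proof -
  obtain \<iota> :: "nat \<Rightarrow> 'a" where \<iota>: "inj \<iota>"
    using assms infinite_countable_subset by blast
  have "inj_on (\<lambda>(S, b). \<iota> (2 * set_encode S + of_bool b)) ({S. finite S} \<times> UNIV)"
  proof (rule inj_onI, clarsimp dest!: injD[OF \<iota>])
    fix S T b c
    assume "finite S" "finite T"
      and eq: "2 * set_encode S + of_bool b = 2 * set_encode T + (of_bool c :: nat)"
    moreover have "b = c" using arg_cong[OF eq, of even] by (cases b; cases c) simp_all
    moreover from this have "set_encode S = set_encode T" using eq by simp
    ultimately show "S = T \<and> b = c" by (simp add: set_encode_eq)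
  qed
  then show ?thesis by blast
qed

lemma rig_dagger_simps:
  "ob (rig_dagger X) = simp (und X) 0"
  "mapsp (rig_dagger X) = rig_space (und X)"
  by (simp_all add: rig_dagger_def rig_def scat.defs dscat.defs)

theorem theoremD:
  fixes R :: "'u gen list set dscat01_functor" and r :: "'u gen list set dscat01_family"
  assumes "infinite (UNIV :: 'u set)"
    and "fibrant_replacement R r"
  shows
    "(adjunction sSet_AInv sSet_dagger qtag_shriek (qtag_star :: 'u isset_functor) \<and>
      \<not> quillen_adjunction sSet_AInv DCH_model sSet_dagger (dagger_joyal_model R r)
          qtag_shriek qtag_star) \<and>
     (adjunction sSet_dagger sSet_AInv (qtag_star :: 'u isset_functor) qtag_lower_star \<and>
      \<not> quillen_adjunction sSet_dagger (dagger_joyal_model R r) sSet_AInv DCH_model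
          qtag_star qtag_lower_star) \<and>
     \<not> is_restriction sSet_dagger (dagger_joyal_model R r) qtag_star DCH_model"
proof (intro conjI shriek_star_adjunction star_lower_star_adjunction)
  obtain e :: "nat set \<times> bool \<Rightarrow> 'u" where e: "inj_on e ({S. finite S} \<times> UNIV)"
    using exists_encoding[OF assms(1)] by blast
  let ?A = "twin_points e" and ?B = "twin_isos e" and ?i = "twin_inclusion e"
  let ?qi = "snd qtag_shriek ?A ?B ?i"
  obtain x where "x \<in> ob (rig_dagger (qtag_shriek_ob ?A))"
    and "\<not> weak_htpy_equiv (mapsp (rig_dagger (qtag_shriek_ob ?A)) x x)
      (mapsp (rig_dagger (qtag_shriek_ob ?B)) (?qi 0 x) (?qi 0 x))
      (rig_map (und (qtag_shriek_ob ?A)) (und (qtag_shriek_ob ?B)) ?qi x x)"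
    using shriek_twin_inclusion_not_equiv[OF e] unfolding rig_dagger_simps by (elim bexE)
  then have "\<not> dagger_joyal_equiv R r (qtag_shriek_ob ?A) (qtag_shriek_ob ?B) ?qi"
    unfolding dagger_joyal_equiv_def dagger_DK_equiv_def by blast
  then have not_weq: "\<not> weq (dagger_joyal_model R r) (fst qtag_shriek ?A) (fst qtag_shriek ?B) ?qi"
    by (simp add: dagger_joyal_model_def qtag_shriek_def)
  have "?A \<in> Obj sSet_AInv" "?B \<in> Obj sSet_AInv" "?i \<in> Hom sSet_AInv ?A ?B"
    using twin_points_AInv[OF e] twin_isos_AInv[OF e] twin_inclusion_equivariant[OF e]
    by (simp_all add: sSet_AInv_def)
  moreover have "cof DCH_model ?A ?B ?i \<and> weq DCH_model ?A ?B ?i"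
    using twin_inclusion_normal[OF e] twin_inclusion_joyal_equiv[OF e]
    by (simp add: DCH_model_def)
  ultimately show "\<not> quillen_adjunction sSet_AInv DCH_model sSet_dagger (dagger_joyal_model R r)
      qtag_shriek qtag_star"
    using not_weq unfolding quillen_adjunction_def by blast
next
  show "\<not> quillen_adjunction sSet_dagger (dagger_joyal_model R r) sSet_AInv DCH_model
      qtag_star qtag_lower_star"
    using free_not_normal
    by (auto simp: quillen_adjunction_def dagger_joyal_model_def DCH_model_def qtag_star_def)
  show "\<not> is_restriction sSet_dagger (dagger_joyal_model R r) qtag_star DCH_model"
    using free_not_normal
    by (auto simp: is_restriction_def dagger_joyal_model_def DCH_model_def qtag_star_def)
qed

end
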